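(* Let $\mathcal{D}$ be a unital real associative algebra endowed with a division grading (by a group with neutral element $e$) whose (nonzero) homogeneous components have dimension $4$. Then the centralizer of the neutral component, $C_{\mathcal{D}}(\mathcal{D}_e)=\{X\in\mathcal{D}\mid XY=YX\text{ for all }Y\in\mathcal{D}_e\}$, is also a graded division algebra (with the grading inherited from $\mathcal{D}$), but with (nonzero) homogeneous components of dimension $1$. Besides, the graded algebra $\mathcal{D}$ is isomorphic to the graded tensor product $\mathcal{D}_e\otimes C_{\mathcal{D}}(\mathcal{D}_e)$. Therefore, the isomorphism and equivalence classes of $\mathcal{D}$ are determined by those of $C_{\mathcal{D}}(\mathcal{D}_e)$: if $\mathcal{D}$ and $\mathcal{D}'$ are two such graded algebras and $C_{\mathcal{D}}(\mathcal{D}_e)$ and $C_{\mathcal{D}'}(\mathcal{D}'_e)$ are isomorphic (respectively equivalent) as graded algebras, then so are $\mathcal{D}$ and $\mathcal{D}'$.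
   Context: A grading on an algebra $\mathcal{D}$ by a group $G$ is a vector space decomposition $\mathcal{D}=\bigoplus_{g\in G}\mathcal{D}_g$ with $\mathcal{D}_g\mathcal{D}_h\subseteq\mathcal{D}_{gh}$ for all $g,h$. The support is the set of $g$ with $\mathcal{D}_g\neq0$. A grading on a unital associative algebra is a division grading (and the algebra is a graded division algebra) if every nonzero homogeneous element is invertible. Two $G$-graded algebras $\mathcal{D},\mathcal{E}$ are isomorphic if there is an algebra isomorphism $\psi$ with $\psi(\mathcal{D}_g)=\mathcal{E}_g$ for all $g\in G$. A $G$-graded $\mathcal{D}$ and an $H$-graded $\mathcal{E}$ are equivalent if there is an algebra isomorphism $\psi:\mathcal{D}\to\mathcal{E}$ such that for every $g$ in the support of $\mathcal{D}$ there is $h\in H$ with $\psi(\mathcal{D}_g)=\mathcal{E}_h$. The tensor product is over $\mathbb{R}$. The graded tensor product $\mathcal{D}_e\otimes C_{\mathcal{D}}(\mathcal{D}_e)$ has $\mathcal{D}_e$ concentrated in degree $e$, so its component of degree $g$ is $\mathcal{D}_e\otimes(C_{\mathcal{D}}(\mathcal{D}_e)\cap\mathcal{D}_g)$. *)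

theory Defs
  imports "HOL-Library.Indicator_Function" "HOL-Algebra.QuotRing" "Jordan_Normal_Form.VS_Connect"
begin

text \<open>
  Unital associative real algebras are carrier-based: the records of type \<open>(real, 'a) module\<close>
  that form a vector space over the reals (\<open>class_ring :: real ring\<close>) and a ring with a bilinear
  multiplication. A subalgebra is the same record with a smaller carrier.
\<close>

locale unital_real_algebra =
  vectorspace "class_ring :: real ring" A + ring A for A :: "(real, 'a) module" (structure) +
  assumes smult_mult_left:
      "\<lbrakk>x \<in> carrier A; y \<in> carrier A\<rbrakk> \<Longrightarrow> (r \<odot> x) \<otimes> y = r \<odot> (x \<otimes> y)"
    and smult_mult_right:
      "\<lbrakk>x \<in> carrier A; y \<in> carrier A\<rbrakk> \<Longrightarrow> x \<otimes> (r \<odot> y) = r \<odot> (x \<otimes> y)"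

text \<open>
  \<open>vectorspace.dim\<close> is only meaningful for finite-dimensional spaces.
\<close>

definition has_dim :: "(real, 'a) module \<Rightarrow> 'a set \<Rightarrow> nat \<Rightarrow> bool" where
  "has_dim A V n \<longleftrightarrow>
     vectorspace.fin_dim class_ring (A\<lparr>carrier := V\<rparr>) \<and>
     vectorspace.dim class_ring (A\<lparr>carrier := V\<rparr>) = n"


section \<open>Gradings\<close>

locale graded_algebra =
  group G + unital_real_algebra A
  for G :: "('g, 'm) monoid_scheme" and A :: "(real, 'a) module" +
  fixes \<Gamma> :: "'g \<Rightarrow> 'a set"
  assumes component_subspace:
      "g \<in> carrier G \<Longrightarrow> subspace class_ring (\<Gamma> g) A"
    and direct_sum:
      "x \<in> carrier A \<Longrightarrow>
         \<exists>!f. f \<in> (\<Pi>\<^sub>E g\<in>carrier G. \<Gamma> g) \<and>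
              finite {g \<in> carrier G. f g \<noteq> \<zero>\<^bsub>A\<^esub>} \<and>
              x = finsum A f {g \<in> carrier G. f g \<noteq> \<zero>\<^bsub>A\<^esub>}"
    and component_mult:
      "\<lbrakk>g \<in> carrier G; h \<in> carrier G; x \<in> \<Gamma> g; y \<in> \<Gamma> h\<rbrakk> \<Longrightarrow> x \<otimes>\<^bsub>A\<^esub> y \<in> \<Gamma> (g \<otimes>\<^bsub>G\<^esub> h)"

locale graded_division_algebra = graded_algebra +
  assumes homogeneous_invertible:
    "\<lbrakk>g \<in> carrier G; x \<in> \<Gamma> g; x \<noteq> \<zero>\<^bsub>A\<^esub>\<rbrakk> \<Longrightarrow> x \<in> Units A"

definition grading_support ::
    "('g, 'm) monoid_scheme \<Rightarrow> (real, 'a) module \<Rightarrow> ('g \<Rightarrow> 'a set) \<Rightarrow> 'g set" where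
  "grading_support G A \<Gamma> = {g \<in> carrier G. \<Gamma> g \<noteq> {\<zero>\<^bsub>A\<^esub>}}"

definition algebra_iso :: "(real, 'a) module \<Rightarrow> (real, 'b) module \<Rightarrow> ('a \<Rightarrow> 'b) set" where
  "algebra_iso A B =
     {\<psi> \<in> ring_iso A B. \<forall>r. \<forall>x \<in> carrier A. \<psi> (r \<odot>\<^bsub>A\<^esub> x) = r \<odot>\<^bsub>B\<^esub> \<psi> x}"

definition graded_isomorphic ::
    "('g, 'm) monoid_scheme \<Rightarrow> (real, 'a) module \<Rightarrow> ('g \<Rightarrow> 'a set) \<Rightarrow>
     (real, 'b) module \<Rightarrow> ('g \<Rightarrow> 'b set) \<Rightarrow> bool" where
  "graded_isomorphic G A \<Gamma> B \<Delta> \<longleftrightarrow>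
     (\<exists>\<psi> \<in> algebra_iso A B. \<forall>g \<in> carrier G. \<psi> ` \<Gamma> g = \<Delta> g)"

definition graded_equivalent ::
    "('g, 'm) monoid_scheme \<Rightarrow> (real, 'a) module \<Rightarrow> ('g \<Rightarrow> 'a set) \<Rightarrow>
     ('h, 'n) monoid_scheme \<Rightarrow> (real, 'b) module \<Rightarrow> ('h \<Rightarrow> 'b set) \<Rightarrow> bool" where
  "graded_equivalent G A \<Gamma> H B \<Delta> \<longleftrightarrow>
     (\<exists>\<psi> \<in> algebra_iso A B. \<forall>g \<in> grading_support G A \<Gamma>. \<exists>h \<in> carrier H. \<psi> ` \<Gamma> g = \<Delta> h)"


section \<open>The centralizer of the neutral component\<close>

definition neutral_subalgebra ::
    "('g, 'm) monoid_scheme \<Rightarrow> (real, 'a) module \<Rightarrow> ('g \<Rightarrow> 'a set) \<Rightarrow> (real, 'a) module" where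
  "neutral_subalgebra G D \<Gamma> = D\<lparr>carrier := \<Gamma> \<one>\<^bsub>G\<^esub>\<rparr>"

definition neutral_centralizer ::
    "('g, 'm) monoid_scheme \<Rightarrow> (real, 'a) module \<Rightarrow> ('g \<Rightarrow> 'a set) \<Rightarrow> (real, 'a) module" where
  "neutral_centralizer G D \<Gamma> =
     D\<lparr>carrier := {x \<in> carrier D. \<forall>y \<in> \<Gamma> \<one>\<^bsub>G\<^esub>. x \<otimes>\<^bsub>D\<^esub> y = y \<otimes>\<^bsub>D\<^esub> x}\<rparr>"

definition centralizer_grading ::
    "('g, 'm) monoid_scheme \<Rightarrow> (real, 'a) module \<Rightarrow> ('g \<Rightarrow> 'a set) \<Rightarrow> 'g \<Rightarrow> 'a set" where
  "centralizer_grading G D \<Gamma> g = carrier (neutral_centralizer G D \<Gamma>) \<inter> \<Gamma> g"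


section \<open>Tensor products of real algebras\<close>

text \<open>
  The tensor product of \<open>A\<close> and \<open>B\<close> over the reals is the free real vector space on
  \<open>carrier A \<times> carrier B\<close> (finitely supported functions, with the product of basis vectors taken
  componentwise) modulo the linear span of the bilinearity relations.
\<close>

definition free_algebra ::
    "(real, 'a) module \<Rightarrow> (real, 'b) module \<Rightarrow> (real, 'a \<times> 'b \<Rightarrow> real) module" where
  "free_algebra A B =
    \<lparr>carrier = {f. finite {p. f p \<noteq> 0} \<and> {p. f p \<noteq> 0} \<subseteq> carrier A \<times> carrier B},
     mult = (\<lambda>f h r. \<Sum>(p, q) \<in> {(p, q). f p \<noteq> 0 \<and> h q \<noteq> 0 \<and>
                          (fst p \<otimes>\<^bsub>A\<^esub> fst q, snd p \<otimes>\<^bsub>B\<^esub> snd q) = r}. f p * h q),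
     one = indicator {(\<one>\<^bsub>A\<^esub>, \<one>\<^bsub>B\<^esub>)},
     zero = (\<lambda>p. 0),
     add = (\<lambda>f h p. f p + h p),
     smult = (\<lambda>r f p. r * f p)\<rparr>"

definition bilinear_relations ::
    "(real, 'a) module \<Rightarrow> (real, 'b) module \<Rightarrow> ('a \<times> 'b \<Rightarrow> real) set" where
  "bilinear_relations A B =
     {\<lambda>p. indicator {(a \<oplus>\<^bsub>A\<^esub> a', b)} p - indicator {(a, b)} p - indicator {(a', b)} p | a a' b.
        a \<in> carrier A \<and> a' \<in> carrier A \<and> b \<in> carrier B} \<union>
     {\<lambda>p. indicator {(a, b \<oplus>\<^bsub>B\<^esub> b')} p - indicator {(a, b)} p - indicator {(a, b')} p | a b b'.
        a \<in> carrier A \<and> b \<in> carrier B \<and> b' \<in> carrier B} \<union>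
     {\<lambda>p. indicator {(r \<odot>\<^bsub>A\<^esub> a, b)} p - r * indicator {(a, b)} p | r a b.
        a \<in> carrier A \<and> b \<in> carrier B} \<union>
     {\<lambda>p. indicator {(a, r \<odot>\<^bsub>B\<^esub> b)} p - r * indicator {(a, b)} p | r a b.
        a \<in> carrier A \<and> b \<in> carrier B}"

definition tensor_kernel ::
    "(real, 'a) module \<Rightarrow> (real, 'b) module \<Rightarrow> ('a \<times> 'b \<Rightarrow> real) set" where
  "tensor_kernel A B =
     LinearCombinations.module.span class_ring (free_algebra A B) (bilinear_relations A B)"

text \<open>
  \<open>FactRing\<close> forgets the scalar multiplication; it is put back here, by the same kind of formula
  as for \<open>rcoset_mult\<close>.
\<close>

definition tensor_algebra ::
    "(real, 'a) module \<Rightarrow> (real, 'b) module \<Rightarrow> (real, ('a \<times> 'b \<Rightarrow> real) set) module" where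
  "tensor_algebra A B =
    (let F = free_algebra A B; N = tensor_kernel A B; Q = F Quot N in
     \<lparr>carrier = carrier Q, mult = mult Q, one = one Q, zero = zero Q, add = add Q,
      smult = (\<lambda>r X. \<Union>x\<in>X. N +>\<^bsub>F\<^esub> (r \<odot>\<^bsub>F\<^esub> x))\<rparr>)"

definition pure_tensor ::
    "(real, 'a) module \<Rightarrow> (real, 'b) module \<Rightarrow> 'a \<Rightarrow> 'b \<Rightarrow> ('a \<times> 'b \<Rightarrow> real) set" where
  "pure_tensor A B a b = tensor_kernel A B +>\<^bsub>free_algebra A B\<^esub> indicator {(a, b)}"

text \<open>
  The grading of a tensor product whose first factor is concentrated in the neutral degree and
  whose second factor is graded by \<open>\<Delta>\<close>.
\<close>

definition tensor_grading ::
    "(real, 'a) module \<Rightarrow> (real, 'b) module \<Rightarrow> ('g \<Rightarrow> 'b set) \<Rightarrow>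
     'g \<Rightarrow> ('a \<times> 'b \<Rightarrow> real) set set" where
  "tensor_grading A B \<Delta> g =
     LinearCombinations.module.span class_ring (tensor_algebra A B)
       {pure_tensor A B a b | a b. a \<in> carrier A \<and> b \<in> \<Delta> g}"

end

theory Submission
  imports Defs "Jordan_Normal_Form.Char_Poly"
    "HOL-Computational_Algebra.Fundamental_Theorem_Algebra"
begin

text \<open>
  If the components are four-dimensional, then the neutral component is a four-dimensional real
  division algebra, hence the quaternions: it is spanned by 1 and anticommuting square roots
  \<open>i\<close>, \<open>j\<close>, \<open>k = i j\<close> of -1. For any algebra containing such \<open>i\<close>, \<open>j\<close> the averaging operator
  \<open>x \<mapsto> (x - i x i - j x j - k x k) / 4\<close> projects onto the centralizer of the quaternions, and
  applied to \<open>x\<close>, \<open>- x i\<close>, \<open>- x j\<close>, \<open>- x k\<close> it yields the unique coordinates of \<open>x\<close> with respect to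
  the basis 1, \<open>i\<close>, \<open>j\<close>, \<open>k\<close> over the centralizer. This replaces the Skolem-Noether theorem: the
  operator preserves the components, so every component is free with basis 1, \<open>i\<close>, \<open>j\<close>, \<open>k\<close> over
  its central part, which gives both the tensor decomposition and the extension of an isomorphism of
  centralizers by \<open>i \<mapsto> i'\<close>, \<open>j \<mapsto> j'\<close>.
\<close>


section \<open>Real algebras and quaternions\<close>

text \<open>The neutral component is recognised through one fact: in a finite-dimensional real
  algebra without zero divisors every element satisfies a real quadratic equation, so a non-real
  element is a real affine function of a square root of -1. Commuting elements with equal squares
  agree up to sign. Hence only the real span of 1 and \<open>i\<close> commutes with
  \<open>i\<close>, an element outside it has a nonzero part anticommuting with \<open>i\<close>,
  which rescales to \<open>j\<close>, and only real scalars commute with both. This gives dimension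
  1: if \<open>c\<close> and \<open>y\<close> of equal degree lie in the centralizer and
  \<open>c\<close> is nonzero, then the inverse of \<open>c\<close> times \<open>y\<close> lies in
  it too and has neutral degree, so it is real. The obstacle in the tensor part is that the product
  is a concrete quotient by a span of relations, not by the kernel of a map. Multiplication, sending
  \<open>(a, b)\<close> to \<open>a b\<close>, kills the relations; coordinates over 1,
  \<open>i\<close>, \<open>j\<close>, \<open>k\<close> give a way back that is linear only modulo
  the relations. The cosets are then the level sets of multiplication, and the quotient operations
  can be computed in the algebra itself.\<close>

lemma vectorspace_realI:
  fixes M :: "(real, 'a) module" (structure)
  assumes "abelian_group M"
    and "\<And>r x. x \<in> carrier M \<Longrightarrow> r \<odot> x \<in> carrier M"
    and "\<And>r s x. x \<in> carrier M \<Longrightarrow> (r + s) \<odot> x = r \<odot> x \<oplus> s \<odot> x"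
    and "\<And>r x y. \<lbrakk>x \<in> carrier M; y \<in> carrier M\<rbrakk> \<Longrightarrow> r \<odot> (x \<oplus> y) = r \<odot> x \<oplus> r \<odot> y"
    and "\<And>r s x. x \<in> carrier M \<Longrightarrow> (r * s) \<odot> x = r \<odot> (s \<odot> x)"
    and "\<And>x. x \<in> carrier M \<Longrightarrow> 1 \<odot> x = x"
  shows "vectorspace class_ring M"
  unfolding vectorspace_def Module.module_def
  using assms class_field class_cring.is_cring
  by (auto intro!: Module.module_axioms.intro)

context unital_real_algebra
begin

lemma scale_closed [simp, intro]: "x \<in> carrier A \<Longrightarrow> r \<odot> x \<in> carrier A"
  using smult_closed[of r x] by simp

lemma scale_add: "\<lbrakk>x \<in> carrier A; y \<in> carrier A\<rbrakk> \<Longrightarrow> r \<odot> (x \<oplus> y) = r \<odot> x \<oplus> r \<odot> y"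
  using smult_r_distr[of r x y] by simp

lemma add_scale: "x \<in> carrier A \<Longrightarrow> (r + s) \<odot> x = r \<odot> x \<oplus> s \<odot> x"
  using smult_l_distr[of r s x] by simp

lemma scale_scale [simp]: "x \<in> carrier A \<Longrightarrow> r \<odot> (s \<odot> x) = (r * s) \<odot> x"
  using smult_assoc1[of r s x] by simp

lemma one_scale [simp]: "x \<in> carrier A \<Longrightarrow> 1 \<odot> x = x"
  using smult_one[of x] by simp

lemma zero_scale [simp]: "x \<in> carrier A \<Longrightarrow> 0 \<odot> x = \<zero>"
  using smult_l_null[of x] by simp

lemma scale_zero [simp]: "r \<odot> \<zero> = \<zero>"
  using smult_r_null[of r] by simp

lemma scale_minus [simp]: "x \<in> carrier A \<Longrightarrow> r \<odot> (\<ominus> x) = \<ominus> (r \<odot> x)"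
  using smult_r_minus[of r x] by simp

lemma minus_scale: "x \<in> carrier A \<Longrightarrow> (- r) \<odot> x = \<ominus> (r \<odot> x)"
  using smult_l_minus[of r x] by (simp add: class_ring_simps)

lemma scale_eq_zero_iff: "x \<in> carrier A \<Longrightarrow> r \<odot> x = \<zero> \<longleftrightarrow> r = 0 \<or> x = \<zero>"
  by (metis one_scale scale_scale scale_zero zero_scale field_class.field_inverse)

lemma inv_commute:
  assumes u: "u \<in> Units A" and z: "z \<in> carrier A" and comm: "u \<otimes> z = z \<otimes> u"
  shows "inv u \<otimes> z = z \<otimes> inv u"
proof -
  have cl: "u \<in> carrier A" "inv u \<in> carrier A" using u by auto
  have "inv u \<otimes> (z \<otimes> u) \<otimes> inv u = inv u \<otimes> (u \<otimes> z) \<otimes> inv u" using comm by simp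
  then have "(inv u \<otimes> z) \<otimes> (u \<otimes> inv u) = (inv u \<otimes> u) \<otimes> (z \<otimes> inv u)"
    using cl z by (simp only: m_assoc m_closed)
  then show ?thesis using cl u z by simp
qed

lemma submodule_realI:
  assumes "S \<subseteq> carrier A" "\<zero> \<in> S"
    and "\<And>x y. \<lbrakk>x \<in> S; y \<in> S\<rbrakk> \<Longrightarrow> x \<oplus> y \<in> S" "\<And>r x. x \<in> S \<Longrightarrow> r \<odot> x \<in> S"
  shows "submodule class_ring S A"
  unfolding submodule_def using assms module_axioms by auto

lemma subspace_realI:
  assumes "S \<subseteq> carrier A" "\<zero> \<in> S"
    and "\<And>x y. \<lbrakk>x \<in> S; y \<in> S\<rbrakk> \<Longrightarrow> x \<oplus> y \<in> S" "\<And>r x. x \<in> S \<Longrightarrow> r \<odot> x \<in> S"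
  shows "subspace class_ring S A"
  unfolding subspace_def using submodule_realI[OF assms] vectorspace_axioms by auto

lemma subspaceD:
  assumes "subspace class_ring S A"
  shows "S \<subseteq> carrier A" "\<zero> \<in> S"
    and "\<And>x y. \<lbrakk>x \<in> S; y \<in> S\<rbrakk> \<Longrightarrow> x \<oplus> y \<in> S" "\<And>r x. x \<in> S \<Longrightarrow> r \<odot> x \<in> S"
    and "\<And>x. x \<in> S \<Longrightarrow> \<ominus> x \<in> S"
proof -
  have *: "submodule class_ring S A" using assms unfolding subspace_def by auto
  then show **: "S \<subseteq> carrier A" "\<zero> \<in> S"
    and "\<And>x y. \<lbrakk>x \<in> S; y \<in> S\<rbrakk> \<Longrightarrow> x \<oplus> y \<in> S" and s: "\<And>r x. x \<in> S \<Longrightarrow> r \<odot> x \<in> S"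
    unfolding submodule_def by auto
  show "\<ominus> x \<in> S" if "x \<in> S" for x
    using s[OF that, of "-1"] minus_scale[of x 1] that **(1) by auto
qed

lemma subspace_abelian_group:
  assumes "subspace class_ring S A"
  shows "abelian_group (A\<lparr>carrier := S\<rparr>)"
proof (rule abelian_groupI)
  note S = subspaceD[OF assms]
  show "\<exists>y\<in>carrier (A\<lparr>carrier := S\<rparr>). y \<oplus>\<^bsub>A\<lparr>carrier := S\<rparr>\<^esub> x = \<zero>\<^bsub>A\<lparr>carrier := S\<rparr>\<^esub>"
    if "x \<in> carrier (A\<lparr>carrier := S\<rparr>)" for x
    using S(1) S(5)[of x] that by (auto intro!: bexI[of _ "\<ominus> x"] simp: l_neg)
qed (use subspaceD[OF assms] in \<open>auto simp: subset_iff a_ac\<close>)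

lemma subalgebra_is_algebra:
  assumes S: "subspace class_ring S A" and one: "\<one> \<in> S"
    and mult: "\<And>x y. \<lbrakk>x \<in> S; y \<in> S\<rbrakk> \<Longrightarrow> x \<otimes> y \<in> S"
  shows "unital_real_algebra (A\<lparr>carrier := S\<rparr>)"
proof -
  note S' = subspaceD[OF S]
  have "ring (A\<lparr>carrier := S\<rparr>)"
    using S'(1) one mult
    by (intro ringI subspace_abelian_group[OF S] monoidI) (auto simp: subset_iff m_assoc l_distr r_distr)
  then show ?thesis
    using subspace_is_vs[OF S] S'(1)
    by (intro unital_real_algebra.intro unital_real_algebra_axioms.intro)
       (auto simp: subset_iff smult_mult_left smult_mult_right)
qed

text \<open>\<open>finsum\<close> depends on the carrier of its record, so sums in a subspace and in
  the whole algebra are formally different objects. An infinite index set gives zero for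
  both.\<close>

lemma finsum_subspace:
  assumes S: "subspace class_ring S A" and f: "f \<in> I \<rightarrow> S"
  shows "finsum (A\<lparr>carrier := S\<rparr>) f I = finsum A f I"
proof -
  interpret S: abelian_group "A\<lparr>carrier := S\<rparr>" by (rule subspace_abelian_group[OF S])
  note S' = subspaceD[OF S]
  show ?thesis using f
  proof (induction I rule: infinite_finite_induct)
    case (insert x F)
    then show ?case using S'(1) by (subst S.finsum_insert, auto, subst finsum_insert, auto)
  qed auto
qed

end

section \<open>Coordinates over the centralizer of a pair of quaternion units\<close>

locale quaternionic_algebra = unital_real_algebra +
  fixes i j
  assumes i_closed [simp, intro]: "i \<in> carrier A" and j_closed [simp, intro]: "j \<in> carrier A"
    and i_i: "i \<otimes> i = \<ominus> \<one>" and j_j: "j \<otimes> j = \<ominus> \<one>" and j_i: "j \<otimes> i = \<ominus> (i \<otimes> j)"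
begin

definition k where "k = i \<otimes> j"

text \<open>Only the two generators are tested, which makes membership easy to check. That this is
  the centralizer of the whole neutral component is shown in
  \<open>centralizer_carrier\<close>.\<close>

definition cent where "cent = {x \<in> carrier A. x \<otimes> i = i \<otimes> x \<and> x \<otimes> j = j \<otimes> x}"

definition quad where "quad a b c d = a \<oplus> b \<otimes> i \<oplus> c \<otimes> j \<oplus> d \<otimes> k"

text \<open>Since \<open>- i\<close>, \<open>- j\<close>, \<open>- k\<close> are inverse to
  \<open>i\<close>, \<open>j\<close>, \<open>k\<close>, the summands are the conjugates of
  \<open>x\<close> by 1, \<open>i\<close>, \<open>j\<close>, \<open>k\<close>. This is the mean over
  the quaternion group of order 8, where a unit and its negative conjugate alike; hence the factor
  1/4.\<close>

definition avg where
  "avg x = (1 / 4) \<odot> (x \<ominus> i \<otimes> x \<otimes> i \<ominus> j \<otimes> x \<otimes> j \<ominus> k \<otimes> x \<otimes> k)"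

lemma k_closed [simp, intro]: "k \<in> carrier A" by (simp add: k_def)

lemma i_j: "i \<otimes> j = k" by (simp add: k_def)

lemma i_k: "i \<otimes> k = \<ominus> j"
  unfolding k_def by (subst m_assoc[symmetric]) (auto simp: i_i l_minus)

lemma k_j: "k \<otimes> j = \<ominus> i"
  unfolding k_def by (subst m_assoc) (auto simp: j_j r_minus)

lemma j_k: "j \<otimes> k = i"
  unfolding k_def by (subst m_assoc[symmetric]) (auto simp: j_i i_j l_minus k_j)

lemma k_i: "k \<otimes> i = j"
  unfolding k_def by (subst m_assoc) (auto simp: j_i i_j r_minus i_k)

lemma k_k: "k \<otimes> k = \<ominus> \<one>"
  by (subst (2) k_def) (simp add: m_assoc[symmetric] k_i j_j)

lemmas units_mult = i_i j_j k_k i_j j_i[unfolded i_j] i_k k_i j_k k_j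

text \<open>The multiplication table in front of a further factor: once words are associated to the
  right, adjacent units can be reduced anywhere in a word and not only at its end.\<close>

lemma units_mult_left:
  assumes "x \<in> carrier A"
  shows "i \<otimes> (i \<otimes> x) = \<ominus> x" "j \<otimes> (j \<otimes> x) = \<ominus> x" "k \<otimes> (k \<otimes> x) = \<ominus> x"
    "i \<otimes> (j \<otimes> x) = k \<otimes> x" "j \<otimes> (i \<otimes> x) = \<ominus> (k \<otimes> x)"
    "i \<otimes> (k \<otimes> x) = \<ominus> (j \<otimes> x)" "k \<otimes> (i \<otimes> x) = j \<otimes> x"
    "j \<otimes> (k \<otimes> x) = i \<otimes> x" "k \<otimes> (j \<otimes> x) = \<ominus> (i \<otimes> x)"
  using assms by (simp_all add: m_assoc[symmetric] units_mult l_minus)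

lemmas quat_simps = m_assoc units_mult units_mult_left l_minus r_minus l_distr r_distr a_minus_def
  minus_add

lemma cent_closed: "x \<in> cent \<Longrightarrow> x \<in> carrier A" by (simp add: cent_def)

lemma cent_subspace: "subspace class_ring cent A"
proof (rule subspace_realI)
  show "x \<oplus> y \<in> cent" if "x \<in> cent" "y \<in> cent" for x y
    using that by (simp add: cent_def l_distr r_distr)
  show "r \<odot> x \<in> cent" if "x \<in> cent" for r x
    using that by (simp add: cent_def smult_mult_left smult_mult_right)
qed (auto simp: cent_def)

lemmas centI = subspaceD(2-5)[OF cent_subspace]

lemma cent_minus: "\<lbrakk>x \<in> cent; y \<in> cent\<rbrakk> \<Longrightarrow> x \<ominus> y \<in> cent"
  by (simp add: a_minus_def centI cent_closed)

lemma cent_one: "\<one> \<in> cent" by (simp add: cent_def)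

lemma cent_mult: "\<lbrakk>x \<in> cent; y \<in> cent\<rbrakk> \<Longrightarrow> x \<otimes> y \<in> cent"
  unfolding cent_def by (auto simp: m_assoc) (metis i_closed j_closed m_assoc)+

lemma cent_commute:
  assumes "c \<in> cent"
  shows "i \<otimes> c = c \<otimes> i" "j \<otimes> c = c \<otimes> j" "k \<otimes> c = c \<otimes> k"
proof -
  have c: "c \<in> carrier A" "i \<otimes> c = c \<otimes> i" "j \<otimes> c = c \<otimes> j" using assms by (auto simp: cent_def)
  then show "i \<otimes> c = c \<otimes> i" "j \<otimes> c = c \<otimes> j" by auto
  show "k \<otimes> c = c \<otimes> k"
    unfolding k_def using c by (metis i_closed j_closed m_assoc)
qed

declare cent_closed [simp]

lemma cent_commute_left:
  assumes "c \<in> cent" "x \<in> carrier A"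
  shows "i \<otimes> (c \<otimes> x) = c \<otimes> (i \<otimes> x)" "j \<otimes> (c \<otimes> x) = c \<otimes> (j \<otimes> x)" "k \<otimes> (c \<otimes> x) = c \<otimes> (k \<otimes> x)"
  using assms by (simp_all add: m_assoc[symmetric] cent_commute)

lemma quad_closed [simp]:
  "\<lbrakk>a \<in> carrier A; b \<in> carrier A; c \<in> carrier A; d \<in> carrier A\<rbrakk> \<Longrightarrow> quad a b c d \<in> carrier A"
  by (simp add: quad_def)

lemma avg_closed [simp]: "x \<in> carrier A \<Longrightarrow> avg x \<in> carrier A"
  by (simp add: avg_def)

text \<open>Conjugation by \<open>i\<close> or by \<open>j\<close> merely permutes the four
  conjugates that are summed.\<close>

lemma avg_cent: 
  assumes "x \<in> carrier A"
  shows "avg x \<in> cent"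
proof -
  let ?B = "x \<ominus> i \<otimes> x \<otimes> i \<ominus> j \<otimes> x \<otimes> j \<ominus> k \<otimes> x \<otimes> k"
  have "?B \<otimes> i = i \<otimes> ?B" "?B \<otimes> j = j \<otimes> ?B"
    using assms by (simp_all add: quat_simps a_ac)
  then have "?B \<in> cent" using assms by (simp add: cent_def del: cent_closed)
  then show ?thesis unfolding avg_def by (rule centI)
qed

lemma avg_add: "\<lbrakk>x \<in> carrier A; y \<in> carrier A\<rbrakk> \<Longrightarrow> avg (x \<oplus> y) = avg x \<oplus> avg y"
  by (simp add: avg_def scale_add[symmetric] quat_simps a_ac)

lemma four_scale: "x \<in> carrier A \<Longrightarrow> x \<oplus> x \<oplus> x \<oplus> x = 4 \<odot> x"
  using add_scale[of x 1 1] add_scale[of x 2 1] add_scale[of x 3 1] by simp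

text \<open>All four conjugates of \<open>c\<close> equal \<open>c\<close>. A unit such as
  \<open>i\<close> is fixed under conjugation by 1 and \<open>i\<close> and negated by
  \<open>j\<close> and \<open>k\<close>, so its conjugates cancel in pairs.\<close>

lemma avg_cent_mult:
  assumes "c \<in> cent" 
  shows "avg c = c" "avg (c \<otimes> i) = \<zero>" "avg (c \<otimes> j) = \<zero>" "avg (c \<otimes> k) = \<zero>"
proof -
  have c: "c \<in> carrier A" using assms by simp
  have "c \<ominus> i \<otimes> c \<otimes> i \<ominus> j \<otimes> c \<otimes> j \<ominus> k \<otimes> c \<otimes> k = 4 \<odot> c"
    using assms c by (simp add: quat_simps cent_commute cent_commute_left four_scale[symmetric])
  then show "avg c = c" using c by (simp add: avg_def)
  have "c \<otimes> i \<ominus> i \<otimes> (c \<otimes> i) \<otimes> i \<ominus> j \<otimes> (c \<otimes> i) \<otimes> j \<ominus> k \<otimes> (c \<otimes> i) \<otimes> k = \<zero>"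
    using assms c by (simp add: quat_simps cent_commute cent_commute_left a_assoc r_neg r_neg1 r_neg2 l_neg)
  then show "avg (c \<otimes> i) = \<zero>" by (simp add: avg_def)
  have "c \<otimes> j \<ominus> i \<otimes> (c \<otimes> j) \<otimes> i \<ominus> j \<otimes> (c \<otimes> j) \<otimes> j \<ominus> k \<otimes> (c \<otimes> j) \<otimes> k = \<zero>"
    using assms c by (simp add: quat_simps cent_commute cent_commute_left a_assoc r_neg r_neg1 r_neg2 l_neg)
  then show "avg (c \<otimes> j) = \<zero>" by (simp add: avg_def)
  have "c \<otimes> k \<ominus> i \<otimes> (c \<otimes> k) \<otimes> i \<ominus> j \<otimes> (c \<otimes> k) \<otimes> j \<ominus> k \<otimes> (c \<otimes> k) \<otimes> k = \<zero>"
    using assms c by (simp add: quat_simps cent_commute cent_commute_left a_assoc r_neg r_neg1 r_neg2 l_neg)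
  then show "avg (c \<otimes> k) = \<zero>" by (simp add: avg_def)
qed

lemma quad_avg:
  assumes x: "x \<in> carrier A"
  shows "x = quad (avg x) (avg (\<ominus> (x \<otimes> i))) (avg (\<ominus> (x \<otimes> j))) (avg (\<ominus> (x \<otimes> k)))"
proof -
  define B where "B y = y \<ominus> i \<otimes> y \<otimes> i \<ominus> j \<otimes> y \<otimes> j \<ominus> k \<otimes> y \<otimes> k" for y
  have B [simp]: "B y \<in> carrier A" if "y \<in> carrier A" for y using that by (simp add: B_def)
  \<comment> \<open>Here \<open>p\<close>, \<open>q\<close>, \<open>r\<close> stand for
    \<open>i x i\<close>, \<open>j x j\<close>, \<open>k x k\<close>, and the four groups come from
    the four coordinates of \<open>x\<close>. Each of \<open>p\<close>, \<open>q\<close>,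
    \<open>r\<close> occurs twice with either sign, so only four copies of \<open>x\<close>
    survive.\<close>
  have *: "y \<oplus> \<ominus> p \<oplus> \<ominus> q \<oplus> \<ominus> r \<oplus> (y \<oplus> \<ominus> p \<oplus> q \<oplus> r) \<oplus> (y \<oplus> p \<oplus> \<ominus> q \<oplus> r)
      \<oplus> (y \<oplus> p \<oplus> q \<oplus> \<ominus> r) = y \<oplus> y \<oplus> y \<oplus> y"
    if "y \<in> carrier A" "p \<in> carrier A" "q \<in> carrier A" "r \<in> carrier A" for y p q r
    using that by algebra
  have "B x \<oplus> B (\<ominus> (x \<otimes> i)) \<otimes> i \<oplus> B (\<ominus> (x \<otimes> j)) \<otimes> j \<oplus> B (\<ominus> (x \<otimes> k)) \<otimes> k
      = x \<oplus> x \<oplus> x \<oplus> x"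
    using x unfolding B_def by (simp add: quat_simps *)
  then have "(1/4) \<odot> (B x \<oplus> B (\<ominus> (x \<otimes> i)) \<otimes> i \<oplus> B (\<ominus> (x \<otimes> j)) \<otimes> j \<oplus> B (\<ominus> (x \<otimes> k)) \<otimes> k) = x"
    using x by (simp add: four_scale)
  then show ?thesis
    using x unfolding quad_def avg_def B_def[symmetric] by (simp add: smult_mult_left scale_add)
qed

text \<open>Hamilton's product with coefficients in the centralizer. That algebra may be
  noncommutative, so in every product of coefficients the left factor comes from the left
  quaternion.\<close>

lemma quad_mult:
  assumes "a \<in> cent" "b \<in> cent" "c \<in> cent" "d \<in> cent" "a' \<in> cent" "b' \<in> cent" "c' \<in> cent" "d' \<in> cent"
  shows "quad a b c d \<otimes> quad a' b' c' d' =
    quad (a \<otimes> a' \<ominus> b \<otimes> b' \<ominus> c \<otimes> c' \<ominus> d \<otimes> d') (a \<otimes> b' \<oplus> b \<otimes> a' \<oplus> c \<otimes> d' \<ominus> d \<otimes> c')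
      (a \<otimes> c' \<oplus> c \<otimes> a' \<oplus> d \<otimes> b' \<ominus> b \<otimes> d') (a \<otimes> d' \<oplus> d \<otimes> a' \<oplus> b \<otimes> c' \<ominus> c \<otimes> b')"
  using assms unfolding quad_def by (simp add: quat_simps cent_commute cent_commute_left a_ac)

lemma quad_add:
  assumes "a \<in> carrier A" "b \<in> carrier A" "c \<in> carrier A" "d \<in> carrier A"
    and "a' \<in> carrier A" "b' \<in> carrier A" "c' \<in> carrier A" "d' \<in> carrier A"
  shows "quad a b c d \<oplus> quad a' b' c' d' = quad (a \<oplus> a') (b \<oplus> b') (c \<oplus> c') (d \<oplus> d')"
  using assms unfolding quad_def by (simp add: l_distr a_ac)

lemma quad_scale:
  assumes "a \<in> carrier A" "b \<in> carrier A" "c \<in> carrier A" "d \<in> carrier A"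
  shows "r \<odot> quad a b c d = quad (r \<odot> a) (r \<odot> b) (r \<odot> c) (r \<odot> d)"
  using assms unfolding quad_def by (simp add: scale_add smult_mult_left)

lemma avg_quad:
  assumes "a \<in> cent" "b \<in> cent" "c \<in> cent" "d \<in> cent"
  shows "avg (quad a b c d) = a"
  using assms unfolding quad_def by (simp add: avg_add avg_cent_mult)

text \<open>Right multiplication by \<open>- i\<close>, the inverse of \<open>i\<close>, moves the
  coordinate \<open>b\<close> into the position of 1, where \<open>avg\<close> reads it off;
  likewise for \<open>j\<close> and \<open>k\<close>.\<close>

lemma quad_coords:
  assumes abcd: "a \<in> cent" "b \<in> cent" "c \<in> cent" "d \<in> cent"
  shows "avg (quad a b c d) = a" "avg (\<ominus> (quad a b c d \<otimes> i)) = b"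
    "avg (\<ominus> (quad a b c d \<otimes> j)) = c" "avg (\<ominus> (quad a b c d \<otimes> k)) = d"
proof -
  show "avg (quad a b c d) = a" using assms by (rule avg_quad)
  have "\<ominus> (quad a b c d \<otimes> i) = quad b (\<ominus> a) (\<ominus> d) c"
    "\<ominus> (quad a b c d \<otimes> j) = quad c d (\<ominus> a) (\<ominus> b)"
    "\<ominus> (quad a b c d \<otimes> k) = quad d (\<ominus> c) b (\<ominus> a)"
    using assms unfolding quad_def by (simp_all add: quat_simps a_ac)
  then show "avg (\<ominus> (quad a b c d \<otimes> i)) = b"
    "avg (\<ominus> (quad a b c d \<otimes> j)) = c" "avg (\<ominus> (quad a b c d \<otimes> k)) = d"
    using abcd by (simp_all add: avg_quad centI)
qed

lemma quad_eq_iff: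
  assumes "a \<in> cent" "b \<in> cent" "c \<in> cent" "d \<in> cent" "a' \<in> cent" "b' \<in> cent" "c' \<in> cent" "d' \<in> cent"
  shows "quad a b c d = quad a' b' c' d' \<longleftrightarrow> a = a' \<and> b = b' \<and> c = c' \<and> d = d'"
  using quad_coords[of a b c d] quad_coords[of a' b' c' d'] assms by metis

end


section \<open>Homogeneous projections and centralizers\<close>

context graded_algebra
begin

lemma group_G: "group G"
  by (rule graded_algebra_axioms[unfolded graded_algebra_def, THEN conjunct1])

lemmas G_assoc = monoid.m_assoc[OF group.is_monoid[OF group_G]]

lemma component_closed: "\<lbrakk>g \<in> carrier G; x \<in> \<Gamma> g\<rbrakk> \<Longrightarrow> x \<in> carrier A"
  using subspaceD(1)[OF component_subspace] by blast

lemma component_zero [simp]: "g \<in> carrier G \<Longrightarrow> \<zero>\<^bsub>A\<^esub> \<in> \<Gamma> g"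
  using subspaceD(2)[OF component_subspace] by blast

definition proj where
  "proj g x = (THE f. f \<in> (\<Pi>\<^sub>E g\<in>carrier G. \<Gamma> g) \<and> finite {g \<in> carrier G. f g \<noteq> \<zero>\<^bsub>A\<^esub>} \<and>
     x = finsum A f {g \<in> carrier G. f g \<noteq> \<zero>\<^bsub>A\<^esub>}) g"

lemma proj_props:
  assumes "x \<in> carrier A"
  shows proj_mem: "g \<in> carrier G \<Longrightarrow> proj g x \<in> \<Gamma> g"
    and finite_proj: "finite {g \<in> carrier G. proj g x \<noteq> \<zero>\<^bsub>A\<^esub>}"
    and sum_proj: "finsum A (\<lambda>g. proj g x) {g \<in> carrier G. proj g x \<noteq> \<zero>\<^bsub>A\<^esub>} = x"
  using theI'[OF direct_sum[OF assms]] unfolding proj_def by auto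

lemma proj_closed [simp]: "\<lbrakk>x \<in> carrier A; g \<in> carrier G\<rbrakk> \<Longrightarrow> proj g x \<in> carrier A"
  using proj_mem component_closed by blast

text \<open>A finite sum with one summand per degree, extended by zero to the other degrees, is
  already a homogeneous decomposition, so uniqueness identifies it with the one selected by
  \<open>proj\<close>.\<close>

lemma proj_finsum:
  assumes S: "finite S" "S \<subseteq> carrier G" and f: "\<And>g. g \<in> S \<Longrightarrow> f g \<in> \<Gamma> g" and g: "g \<in> carrier G"
  shows "proj g (finsum A f S) = (if g \<in> S then f g else \<zero>\<^bsub>A\<^esub>)"
proof -
  define F where "F = restrict (\<lambda>g. if g \<in> S then f g else \<zero>\<^bsub>A\<^esub>) (carrier G)"
  have fA: "f \<in> S \<rightarrow> carrier A" using f S(2) component_closed by blast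
  have supp: "{g \<in> carrier G. F g \<noteq> \<zero>\<^bsub>A\<^esub>} = {g \<in> S. f g \<noteq> \<zero>\<^bsub>A\<^esub>}"
    using S(2) by (auto simp: F_def)
  have F1: "F \<in> (\<Pi>\<^sub>E g\<in>carrier G. \<Gamma> g)"
    unfolding F_def restrict_PiE_iff using f by auto
  have F2: "finite {g \<in> carrier G. F g \<noteq> \<zero>\<^bsub>A\<^esub>}"
    unfolding supp using S(1) by auto
  have "finsum A f S = finsum A F {g \<in> S. f g \<noteq> \<zero>\<^bsub>A\<^esub>}"
    using S fA by (intro add.finprod_mono_neutral_cong_right) (auto simp: F_def)
  then have F3: "finsum A f S = finsum A F {g \<in> carrier G. F g \<noteq> \<zero>\<^bsub>A\<^esub>}"
    unfolding supp .
  have "(THE f'. f' \<in> (\<Pi>\<^sub>E g\<in>carrier G. \<Gamma> g) \<and> finite {g \<in> carrier G. f' g \<noteq> \<zero>\<^bsub>A\<^esub>} \<and>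
     finsum A f S = finsum A f' {g \<in> carrier G. f' g \<noteq> \<zero>\<^bsub>A\<^esub>}) = F"
    by (intro the1_equality[OF direct_sum[OF finsum_closed[OF fA]]] conjI F1 F2 F3)
  then show ?thesis unfolding proj_def using g by (simp add: F_def)
qed

lemma proj_homogeneous:
  assumes "h \<in> carrier G" "x \<in> \<Gamma> h" "g \<in> carrier G"
  shows "proj g x = (if g = h then x else \<zero>\<^bsub>A\<^esub>)"
  using proj_finsum[of "{h}" "\<lambda>_. x" g] assms component_closed by simp

text \<open>Multiplication by an element of degree \<open>g\<close> translates degrees by a
  bijection of the group, so it carries the decomposition of \<open>x\<close> to that of the
  product. The function \<open>?f\<close> re-indexes the summands by their new degree.\<close>

lemma proj_mult_left:
  assumes g: "g \<in> carrier G" and h: "h \<in> carrier G" and a: "a \<in> \<Gamma> g" and x: "x \<in> carrier A"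
  shows "proj (g \<otimes>\<^bsub>G\<^esub> h) (a \<otimes>\<^bsub>A\<^esub> x) = a \<otimes>\<^bsub>A\<^esub> proj h x"
proof -
  define S where "S = {g \<in> carrier G. proj g x \<noteq> \<zero>\<^bsub>A\<^esub>}"
  let ?m = "\<lambda>k. g \<otimes>\<^bsub>G\<^esub> k"
  let ?f = "\<lambda>k. a \<otimes>\<^bsub>A\<^esub> proj (inv\<^bsub>G\<^esub> g \<otimes>\<^bsub>G\<^esub> k) x"
  have aA: "a \<in> carrier A" using a g component_closed by blast
  have S: "finite S" "S \<subseteq> carrier G" using finite_proj[OF x] by (auto simp: S_def)
  have m: "inv\<^bsub>G\<^esub> g \<otimes>\<^bsub>G\<^esub> (g \<otimes>\<^bsub>G\<^esub> k) = k" if "k \<in> carrier G" for k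
    using g that by (simp add: G_assoc[symmetric])
  have m': "g \<otimes>\<^bsub>G\<^esub> (inv\<^bsub>G\<^esub> g \<otimes>\<^bsub>G\<^esub> k) = k" if "k \<in> carrier G" for k
    using g that by (simp add: G_assoc[symmetric])
  have inj': "inj_on ?m (carrier G)" by (rule inj_on_inverseI, rule m)
  have inj: "inj_on ?m S" using inj_on_subset[OF inj' S(2)] .
  have "a \<otimes>\<^bsub>A\<^esub> x = a \<otimes>\<^bsub>A\<^esub> finsum A (\<lambda>k. proj k x) S"
    using sum_proj[OF x] by (simp add: S_def)
  also have "\<dots> = finsum A (\<lambda>k. a \<otimes>\<^bsub>A\<^esub> proj k x) S"
    using S aA x by (intro finsum_rdistr) auto
  also have "\<dots> = finsum A (\<lambda>k. ?f (?m k)) S"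
    using S aA x m by (intro finsum_cong') (auto simp: subset_iff)
  also have "\<dots> = finsum A ?f (?m ` S)"
    using S aA x g by (intro add.finprod_reindex[symmetric] inj) (auto simp: subset_iff)
  finally have eq: "a \<otimes>\<^bsub>A\<^esub> x = finsum A ?f (?m ` S)" .
  have "?f k \<in> \<Gamma> k" if "k \<in> carrier G" for k
    using component_mult[OF g _ a proj_mem[OF x], of "inv\<^bsub>G\<^esub> g \<otimes>\<^bsub>G\<^esub> k"] that g m' by simp
  then have mem: "?f k \<in> \<Gamma> k" if "k \<in> ?m ` S" for k
    using that S(2) g by (auto simp: subset_iff)
  have mS: "finite (?m ` S)" "?m ` S \<subseteq> carrier G" "?m h \<in> carrier G"
    using S g h by auto
  have "proj (?m h) (a \<otimes>\<^bsub>A\<^esub> x) = (if ?m h \<in> ?m ` S then ?f (?m h) else \<zero>\<^bsub>A\<^esub>)"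
    unfolding eq by (rule proj_finsum[OF mS(1,2) mem mS(3)])
  moreover have "?m h \<in> ?m ` S \<longleftrightarrow> h \<in> S"
    by (rule inj_on_image_mem_iff[OF inj' h S(2)])
  ultimately show ?thesis using m[OF h] h aA by (auto simp: S_def)
qed

text \<open>Neither the group nor the algebra is commutative, so the mirror image needs its own
  proof. Both sides are used to compare the components of \<open>x y\<close> and
  \<open>y x\<close>.\<close>

lemma proj_mult_right:
  assumes g: "g \<in> carrier G" and h: "h \<in> carrier G" and a: "a \<in> \<Gamma> g" and x: "x \<in> carrier A"
  shows "proj (h \<otimes>\<^bsub>G\<^esub> g) (x \<otimes>\<^bsub>A\<^esub> a) = proj h x \<otimes>\<^bsub>A\<^esub> a"
proof -
  define S where "S = {g \<in> carrier G. proj g x \<noteq> \<zero>\<^bsub>A\<^esub>}"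
  let ?m = "\<lambda>k. k \<otimes>\<^bsub>G\<^esub> g"
  let ?f = "\<lambda>k. proj (k \<otimes>\<^bsub>G\<^esub> inv\<^bsub>G\<^esub> g) x \<otimes>\<^bsub>A\<^esub> a"
  have aA: "a \<in> carrier A" using a g component_closed by blast
  have S: "finite S" "S \<subseteq> carrier G" using finite_proj[OF x] by (auto simp: S_def)
  have m: "k \<otimes>\<^bsub>G\<^esub> g \<otimes>\<^bsub>G\<^esub> inv\<^bsub>G\<^esub> g = k" if "k \<in> carrier G" for k
    using g that by (simp add: G_assoc)
  have m': "k \<otimes>\<^bsub>G\<^esub> inv\<^bsub>G\<^esub> g \<otimes>\<^bsub>G\<^esub> g = k" if "k \<in> carrier G" for k
    using g that by (simp add: G_assoc)
  have inj': "inj_on ?m (carrier G)" by (rule inj_on_inverseI, rule m)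
  have inj: "inj_on ?m S" using inj_on_subset[OF inj' S(2)] .
  have "x \<otimes>\<^bsub>A\<^esub> a = finsum A (\<lambda>k. proj k x) S \<otimes>\<^bsub>A\<^esub> a"
    using sum_proj[OF x] by (simp add: S_def)
  also have "\<dots> = finsum A (\<lambda>k. proj k x \<otimes>\<^bsub>A\<^esub> a) S"
    using S aA x by (intro finsum_ldistr) auto
  also have "\<dots> = finsum A (\<lambda>k. ?f (?m k)) S"
    using S aA x m by (intro finsum_cong') (auto simp: subset_iff)
  also have "\<dots> = finsum A ?f (?m ` S)"
    using S aA x g by (intro add.finprod_reindex[symmetric] inj) (auto simp: subset_iff)
  finally have eq: "x \<otimes>\<^bsub>A\<^esub> a = finsum A ?f (?m ` S)" .
  have "?f k \<in> \<Gamma> k" if "k \<in> carrier G" for k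
    using component_mult[OF _ g proj_mem[OF x] a, of "k \<otimes>\<^bsub>G\<^esub> inv\<^bsub>G\<^esub> g"] that g m' by simp
  then have mem: "?f k \<in> \<Gamma> k" if "k \<in> ?m ` S" for k
    using that S(2) g by (auto simp: subset_iff)
  have mS: "finite (?m ` S)" "?m ` S \<subseteq> carrier G" "?m h \<in> carrier G"
    using S g h by auto
  have "proj (?m h) (x \<otimes>\<^bsub>A\<^esub> a) = (if ?m h \<in> ?m ` S then ?f (?m h) else \<zero>\<^bsub>A\<^esub>)"
    unfolding eq by (rule proj_finsum[OF mS(1,2) mem mS(3)])
  moreover have "?m h \<in> ?m ` S \<longleftrightarrow> h \<in> S"
    by (rule inj_on_image_mem_iff[OF inj' h S(2)])
  ultimately show ?thesis using m[OF h] h aA by (auto simp: S_def)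
qed

text \<open>The neutral part \<open>?e\<close> of the unit fixes every homogeneous part of the unit
  from the right; summing these parts gives \<open>?e\<close> = 1.\<close>

lemma one_neutral: "\<one>\<^bsub>A\<^esub> \<in> \<Gamma> \<one>\<^bsub>G\<^esub>"
proof -
  let ?e = "proj \<one>\<^bsub>G\<^esub> \<one>\<^bsub>A\<^esub>"
  let ?S = "{g \<in> carrier G. proj g \<one>\<^bsub>A\<^esub> \<noteq> \<zero>\<^bsub>A\<^esub>}"
  have e: "proj g \<one>\<^bsub>A\<^esub> \<otimes>\<^bsub>A\<^esub> ?e = proj g \<one>\<^bsub>A\<^esub>" if "g \<in> carrier G" for g
    using proj_mult_left[OF that _ proj_mem[OF _ that], of "\<one>\<^bsub>G\<^esub>" "\<one>\<^bsub>A\<^esub>" "\<one>\<^bsub>A\<^esub>"] that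
      proj_homogeneous[OF that proj_mem[OF _ that] that] by simp
  have "?e = finsum A (\<lambda>g. proj g \<one>\<^bsub>A\<^esub>) ?S \<otimes>\<^bsub>A\<^esub> ?e"
    by (subst sum_proj) auto
  also have "\<dots> = finsum A (\<lambda>g. proj g \<one>\<^bsub>A\<^esub> \<otimes>\<^bsub>A\<^esub> ?e) ?S"
    by (intro finsum_ldistr finite_proj) auto
  also have "\<dots> = finsum A (\<lambda>g. proj g \<one>\<^bsub>A\<^esub>) ?S"
    using e by (intro finsum_cong') auto
  also have "\<dots> = \<one>\<^bsub>A\<^esub>" by (rule sum_proj) simp
  finally show ?thesis using proj_mem[of "\<one>\<^bsub>A\<^esub>" "\<one>\<^bsub>G\<^esub>"] by simp
qed

text \<open>Taking the neutral component of \<open>x\<close> times its inverse shows that one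
  homogeneous part of the inverse is itself a right inverse of \<open>x\<close>, hence is the whole
  inverse.\<close>

lemma inv_homogeneous:
  assumes g: "g \<in> carrier G" and x: "x \<in> \<Gamma> g" "x \<in> Units A"
  shows "inv\<^bsub>A\<^esub> x \<in> \<Gamma> (inv\<^bsub>G\<^esub> g)"
proof -
  have cl: "x \<in> carrier A" "inv\<^bsub>A\<^esub> x \<in> carrier A" using x(2) by auto
  let ?p = "proj (inv\<^bsub>G\<^esub> g) (inv\<^bsub>A\<^esub> x)"
  have "x \<otimes>\<^bsub>A\<^esub> ?p = proj (g \<otimes>\<^bsub>G\<^esub> inv\<^bsub>G\<^esub> g) (x \<otimes>\<^bsub>A\<^esub> inv\<^bsub>A\<^esub> x)"
    using g x(1) cl by (intro proj_mult_left[symmetric]) auto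
  also have "\<dots> = \<one>\<^bsub>A\<^esub>"
    using g x(2) one_neutral proj_homogeneous[of "\<one>\<^bsub>G\<^esub>" "\<one>\<^bsub>A\<^esub>" "\<one>\<^bsub>G\<^esub>"] by simp
  finally have "inv\<^bsub>A\<^esub> x \<otimes>\<^bsub>A\<^esub> (x \<otimes>\<^bsub>A\<^esub> ?p) = inv\<^bsub>A\<^esub> x" using cl by simp
  then have "?p = inv\<^bsub>A\<^esub> x"
    using g x(2) cl by (simp add: m_assoc[symmetric])
  then show ?thesis using proj_mem[OF cl(2), of "inv\<^bsub>G\<^esub> g"] g by simp
qed

text \<open>Closure under the projections keeps the homogeneous parts of an element of
  \<open>S\<close> inside \<open>S\<close>, which gives existence of the decomposition; uniqueness
  is inherited from the larger algebra.\<close>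

lemma graded_subalgebra:
  assumes S: "subspace class_ring S A" and one: "\<one>\<^bsub>A\<^esub> \<in> S"
    and mult: "\<And>x y. \<lbrakk>x \<in> S; y \<in> S\<rbrakk> \<Longrightarrow> x \<otimes>\<^bsub>A\<^esub> y \<in> S"
    and proj: "\<And>g x. \<lbrakk>g \<in> carrier G; x \<in> S\<rbrakk> \<Longrightarrow> proj g x \<in> S"
  shows "graded_algebra G (A\<lparr>carrier := S\<rparr>) (\<lambda>g. S \<inter> \<Gamma> g)"
proof -
  let ?A = "A\<lparr>carrier := S\<rparr>"
  interpret S: unital_real_algebra ?A by (rule subalgebra_is_algebra[OF S one mult])
  note S' = subspaceD[OF S]
  have ds: "\<exists>!f. f \<in> (\<Pi>\<^sub>E g\<in>carrier G. S \<inter> \<Gamma> g) \<and> finite {g \<in> carrier G. f g \<noteq> \<zero>\<^bsub>A\<^esub>} \<and>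
              x = finsum ?A f {g \<in> carrier G. f g \<noteq> \<zero>\<^bsub>A\<^esub>}" (is "\<exists>!f. ?P f") if x: "x \<in> S" for x
  proof (rule ex_ex1I)
    have xA: "x \<in> carrier A" using x S'(1) by auto
    have *: "finsum ?A f {g \<in> carrier G. f g \<noteq> \<zero>\<^bsub>A\<^esub>} = finsum A f {g \<in> carrier G. f g \<noteq> \<zero>\<^bsub>A\<^esub>}"
      if "f \<in> (\<Pi>\<^sub>E g\<in>carrier G. S \<inter> \<Gamma> g)" for f
      using that by (intro finsum_subspace S) auto
    define f where "f = restrict (\<lambda>g. proj g x) (carrier G)"
    have f: "f \<in> (\<Pi>\<^sub>E g\<in>carrier G. S \<inter> \<Gamma> g)"
      using proj[OF _ x] proj_mem[OF xA] by (auto simp: f_def)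
    have supp: "{g \<in> carrier G. f g \<noteq> \<zero>\<^bsub>A\<^esub>} = {g \<in> carrier G. proj g x \<noteq> \<zero>\<^bsub>A\<^esub>}"
      by (auto simp: f_def)
    have "finsum A f {g \<in> carrier G. f g \<noteq> \<zero>\<^bsub>A\<^esub>} = x"
      using sum_proj[OF xA] xA unfolding supp
      by (subst finsum_cong'[where g = "\<lambda>g. proj g x"]) (auto simp: f_def)
    then have "?P f" using f *[OF f] finite_proj[OF xA] by (simp add: supp)
    then show "\<exists>f. ?P f" by blast
    show "f1 = f2" if f12: "?P f1" "?P f2" for f1 f2
    proof -
      have "f \<in> (\<Pi>\<^sub>E g\<in>carrier G. \<Gamma> g) \<and> finite {g \<in> carrier G. f g \<noteq> \<zero>\<^bsub>A\<^esub>} \<and>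
              x = finsum A f {g \<in> carrier G. f g \<noteq> \<zero>\<^bsub>A\<^esub>}" if "?P f" for f
        using that *[of f] by (auto simp: PiE_iff)
      then show ?thesis using f12 direct_sum[OF xA] by blast
    qed
  qed
  show ?thesis
  proof (intro graded_algebra.intro graded_algebra_axioms.intro)
    show "group G" by (rule group_G)
    show "unital_real_algebra ?A" by (rule S.unital_real_algebra_axioms)
    show "subspace class_ring (S \<inter> \<Gamma> g) ?A" if "g \<in> carrier G" for g
      using subspaceD[OF component_subspace[OF that]] S'
      by (intro S.subspace_realI) auto
    show "x \<otimes>\<^bsub>?A\<^esub> y \<in> S \<inter> \<Gamma> (g \<otimes>\<^bsub>G\<^esub> h)"
      if "g \<in> carrier G" "h \<in> carrier G" "x \<in> S \<inter> \<Gamma> g" "y \<in> S \<inter> \<Gamma> h" for g h x y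
      using that mult component_mult by auto
  qed (use ds in simp)
qed

end

lemma neutral_centralizer_carrier:
  "carrier (neutral_centralizer G D \<Gamma>) =
    {x \<in> carrier D. \<forall>y \<in> \<Gamma> \<one>\<^bsub>G\<^esub>. x \<otimes>\<^bsub>D\<^esub> y = y \<otimes>\<^bsub>D\<^esub> x}"
  by (simp add: neutral_centralizer_def)

context graded_algebra
begin

lemma centralizer_subspace: "subspace class_ring (carrier (neutral_centralizer G A \<Gamma>)) A"
  unfolding neutral_centralizer_carrier using component_closed[of "\<one>\<^bsub>G\<^esub>"]
  by (intro subspace_realI) (simp_all add: l_distr r_distr smult_mult_left smult_mult_right)

lemma graded_centralizer:
  "graded_algebra G (neutral_centralizer G A \<Gamma>) (centralizer_grading G A \<Gamma>)"
proof -
  let ?C = "carrier (neutral_centralizer G A \<Gamma>)"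
  have cl: "y \<in> carrier A" if "y \<in> \<Gamma> \<one>\<^bsub>G\<^esub>" for y
    using component_closed[of "\<one>\<^bsub>G\<^esub>"] that by simp
  have "graded_algebra G (A\<lparr>carrier := ?C\<rparr>) (\<lambda>g. ?C \<inter> \<Gamma> g)"
  proof (rule graded_subalgebra[OF centralizer_subspace])
    show "\<one>\<^bsub>A\<^esub> \<in> ?C" using cl by (auto simp: neutral_centralizer_carrier)
    show "x \<otimes>\<^bsub>A\<^esub> y \<in> ?C" if "x \<in> ?C" "y \<in> ?C" for x y
    proof -
      have "x \<otimes>\<^bsub>A\<^esub> y \<otimes>\<^bsub>A\<^esub> z = z \<otimes>\<^bsub>A\<^esub> (x \<otimes>\<^bsub>A\<^esub> y)" if z: "z \<in> \<Gamma> \<one>\<^bsub>G\<^esub>" for z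
      proof -
        have "x \<in> carrier A" "y \<in> carrier A" "x \<otimes>\<^bsub>A\<^esub> z = z \<otimes>\<^bsub>A\<^esub> x" "y \<otimes>\<^bsub>A\<^esub> z = z \<otimes>\<^bsub>A\<^esub> y"
          using z \<open>x \<in> ?C\<close> \<open>y \<in> ?C\<close> by (auto simp: neutral_centralizer_carrier)
        then show ?thesis using cl[OF z] by (metis m_assoc)
      qed
      then show ?thesis using that by (simp add: neutral_centralizer_carrier)
    qed
    show "proj g x \<in> ?C" if g: "g \<in> carrier G" and x: "x \<in> ?C" for g x
    proof -
      have xA: "x \<in> carrier A" using x by (simp add: neutral_centralizer_carrier)
      \<comment> \<open>Multiplying by a neutral \<open>y\<close> preserves degrees, so the
        components of degree \<open>g\<close> of \<open>x y = y x\<close> give the claim.\<close>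
      have "proj g x \<otimes>\<^bsub>A\<^esub> y = y \<otimes>\<^bsub>A\<^esub> proj g x" if y: "y \<in> \<Gamma> \<one>\<^bsub>G\<^esub>" for y
      proof -
        have "x \<otimes>\<^bsub>A\<^esub> y = y \<otimes>\<^bsub>A\<^esub> x" using x y by (simp add: neutral_centralizer_carrier)
        then show ?thesis
          using proj_mult_left[OF _ g y xA] proj_mult_right[OF _ g y xA] g by simp
      qed
      then show ?thesis using xA g by (simp add: neutral_centralizer_carrier)
    qed
  qed
  then show ?thesis
    unfolding centralizer_grading_def[abs_def] by (simp add: neutral_centralizer_def)
qed

end

context graded_division_algebra
begin

lemma graded_division_centralizer:
  "graded_division_algebra G (neutral_centralizer G A \<Gamma>) (centralizer_grading G A \<Gamma>)"
proof (intro graded_division_algebra.intro graded_division_algebra_axioms.intro)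
  show "graded_algebra G (neutral_centralizer G A \<Gamma>) (centralizer_grading G A \<Gamma>)"
    by (rule graded_centralizer)
  fix g x
  assume g: "g \<in> carrier G" and "x \<in> centralizer_grading G A \<Gamma> g" and "x \<noteq> \<zero>\<^bsub>neutral_centralizer G A \<Gamma>\<^esub>"
  then have x: "x \<in> carrier (neutral_centralizer G A \<Gamma>)" and u: "x \<in> Units A"
    using homogeneous_invertible[OF g] by (auto simp: centralizer_grading_def neutral_centralizer_def)
  \<comment> \<open>The inverse exists in the whole algebra; since it commutes with whatever
    \<open>x\<close> commutes with, it is also an inverse inside the centralizer.\<close>
  have "inv\<^bsub>A\<^esub> x \<otimes>\<^bsub>A\<^esub> y = y \<otimes>\<^bsub>A\<^esub> inv\<^bsub>A\<^esub> x" if y: "y \<in> \<Gamma> \<one>\<^bsub>G\<^esub>" for y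
    using x y component_closed[OF _ y] by (intro inv_commute u) (simp_all add: neutral_centralizer_carrier)
  then have "inv\<^bsub>A\<^esub> x \<in> carrier (neutral_centralizer G A \<Gamma>)"
    using u by (simp add: neutral_centralizer_carrier)
  then show "x \<in> Units (neutral_centralizer G A \<Gamma>)"
    using x Units_l_inv[OF u] Units_r_inv[OF u] unfolding Units_def
    by (auto simp: neutral_centralizer_def intro!: bexI[of _ "inv\<^bsub>A\<^esub> x"])
qed

end


section \<open>Four-dimensional real division algebras\<close>

text \<open>A nonreal complex root \<open>z\<close> yields the real quadratic \<open>q\<close> with
  roots \<open>z\<close> and its conjugate. The remainder of \<open>p\<close> modulo
  \<open>q\<close> is real of degree at most 1 and vanishes at \<open>z\<close>, so it is
  zero.\<close>

lemma real_poly_has_quadratic_or_linear_factor: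
  fixes p :: "real poly"
  assumes "degree p > 0"
  shows "(\<exists>c. [:- c, 1:] dvd p) \<or> (\<exists>a b. [:b, a, 1:] dvd p)"
proof -
  interpret h: map_poly_inj_idom_hom complex_of_real ..
  let ?c = "map_poly complex_of_real"
  have "\<not> constant (poly (?c p))"
    using assms by (simp add: constant_degree)
  then obtain z where z: "poly (?c p) z = 0"
    using fundamental_theorem_of_algebra by blast
  show ?thesis
  proof (cases "Im z = 0")
    case True
    then have "z = complex_of_real (Re z)" by (simp add: complex_eq_iff)
    then have "complex_of_real (poly p (Re z)) = 0"
      using z by (metis of_real_hom.poly_map_poly)
    then show ?thesis by (auto simp: poly_eq_0_iff_dvd)
  next
    case False
    define q where "q = [:(Re z)\<^sup>2 + (Im z)\<^sup>2, - 2 * Re z, 1:]"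
    define r where "r = p mod q"
    have "poly (?c q) z = 0"
      by (simp add: q_def complex_eq_iff algebra_simps power2_eq_square)
    moreover have "?c p = ?c (p div q) * ?c q + ?c r"
      unfolding h.hom_mult[symmetric] h.hom_add[symmetric] r_def by simp
    ultimately have rz: "poly (?c r) z = 0" using z by simp
    have "degree r < 2 \<or> r = 0"
      using degree_mod_less[of q p] by (auto simp: r_def q_def)
    then have "degree r \<le> 1" by auto
    then have r: "r = [:coeff r 0, coeff r 1:]"
      by (intro poly_eqI) (auto simp: coeff_pCons coeff_eq_0 split: nat.split)
    have "complex_of_real (coeff r 0) + z * complex_of_real (coeff r 1) = 0"
      using rz by (subst (asm) r) (simp add: of_real_hom.map_poly_pCons_hom)
    then have "coeff r 1 = 0" "coeff r 0 = 0"
      using False by (auto simp: complex_eq_iff)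
    then have "r = 0" using r by simp
    then have "q dvd p" unfolding r_def by (simp add: mod_eq_0_iff_dvd)
    then show ?thesis unfolding q_def by blast
  qed
qed

section \<open>Evaluation of real polynomials and algebraic elements\<close>

context unital_real_algebra
begin

definition aeval where
  "aeval x p = fold_coeffs (\<lambda>a v. a \<odot> \<one> \<oplus> x \<otimes> v) p \<zero>"

lemma aeval_0 [simp]: "aeval x 0 = \<zero>"
  by (simp add: aeval_def)

lemma aeval_pCons [simp]:
  assumes "x \<in> carrier A"
  shows "aeval x (pCons a p) = a \<odot> \<one> \<oplus> x \<otimes> aeval x p"
  using assms by (cases "p = 0 \<and> a = 0") (auto simp: aeval_def)

lemma aeval_closed [simp]: "x \<in> carrier A \<Longrightarrow> aeval x p \<in> carrier A"
  by (induction p) auto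

lemma aeval_add:
  assumes [simp]: "x \<in> carrier A"
  shows "aeval x (p + q) = aeval x p \<oplus> aeval x q"
  by (induction p q rule: poly_induct2) (simp_all add: add_scale r_distr a_ac)

lemma aeval_smult:
  assumes [simp]: "x \<in> carrier A"
  shows "aeval x (Polynomial.smult r p) = r \<odot> aeval x p"
  by (induction p) (simp_all add: scale_add smult_mult_right)

lemma aeval_mult:
  assumes [simp]: "x \<in> carrier A"
  shows "aeval x (p * q) = aeval x p \<otimes> aeval x q"
  by (induction p) (simp_all add: aeval_add aeval_smult l_distr smult_mult_left m_assoc)

lemma aeval_monom:
  assumes [simp]: "x \<in> carrier A"
  shows "aeval x (monom a n) = a \<odot> (x [^] n)"
proof (induction n)
  case (Suc n)
  have "x [^] Suc n = x \<otimes> x [^] n" by (rule nat_pow_Suc2) simp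
  then show ?case using Suc by (simp add: monom_Suc smult_mult_right)
qed (simp add: monom_0)

lemma aeval_sum:
  assumes [simp]: "x \<in> carrier A"
  shows "aeval x (\<Sum>n\<in>I. f n) = finsum A (\<lambda>n. aeval x (f n)) I"
  by (induction I rule: infinite_finite_induct) (auto simp: aeval_add)

text \<open>The powers with exponents \<open>0, ..., dim\<close> are one too many to be independent.
  Coinciding powers form a separate case because linear dependence is a property of sets and does
  not see repetitions; there a difference of two monomials annihilates \<open>x\<close>.\<close>

lemma fin_dim_algebraic:
  assumes fd: fin_dim and x [simp]: "x \<in> carrier A"
  shows "\<exists>p. p \<noteq> 0 \<and> aeval x p = \<zero>"
proof -
  define N where "N = {..dim}"
  show ?thesis
  proof (cases "inj_on (\<lambda>n::nat. x [^] n) N")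
    case False
    then obtain m n :: nat where mn: "m \<noteq> n" "x [^] m = x [^] n" unfolding inj_on_def by blast
    have "aeval x (monom 1 m + monom (- 1) n) = x [^] m \<oplus> \<ominus> (x [^] n)"
      by (simp add: aeval_add aeval_monom minus_scale)
    also have "\<dots> = \<zero>" using mn(2) by (simp add: r_neg)
    finally have "aeval x (monom 1 m + monom (- 1) n) = \<zero>" .
    moreover have "coeff (monom 1 m + monom (- 1) n) m = (1 :: real)" using mn(1) by simp
    then have "monom 1 m + monom (- 1) n \<noteq> (0 :: real poly)" by force
    ultimately show ?thesis by blast
  next
    case True
    let ?S = "(\<lambda>n::nat. x [^] n) ` N"
    have S: "finite ?S" "?S \<subseteq> carrier A" by (auto simp: N_def)
    have "card ?S = Suc dim" using card_image[OF True] by (simp add: N_def)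
    then have "lin_dep ?S" using li_le_dim(2)[OF fd S(2)] by auto
    from finite_lin_dep[OF S(1) this S(2)] obtain a v
      where a: "lincomb a ?S = \<zero>" "v \<in> ?S" "a v \<noteq> 0" by auto
    define p where "p = (\<Sum>n\<in>N. monom (a (x [^] n)) n)"
    have "aeval x p = finsum A (\<lambda>n. a (x [^] n) \<odot> (x [^] n)) N"
      unfolding p_def by (simp add: aeval_sum aeval_monom)
    also have "\<dots> = lincomb a ?S"
      unfolding lincomb_def by (rule add.finprod_reindex[symmetric]) (use True in auto)
    finally have "aeval x p = \<zero>" using a by simp
    moreover obtain n where n: "n \<in> N" "v = x [^] n" using a by blast
    then have "coeff p n = a v" unfolding p_def by (simp add: coeff_sum N_def if_distrib)
    then have "p \<noteq> 0" using a by auto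
    ultimately show ?thesis by blast
  qed
qed

end

text \<open>Division enters as absence of zero divisors, the form in which factorisations of
  polynomials and of differences of squares are exploited.\<close>

locale real_division_algebra4 = unital_real_algebra +
  assumes fin_dim: fin_dim and dim4: "dim = 4"
    and domain: "\<lbrakk>x \<in> carrier A; y \<in> carrier A; x \<otimes> y = \<zero>\<rbrakk> \<Longrightarrow> x = \<zero> \<or> y = \<zero>"
begin

lemma not_spanned:
  assumes "S \<subseteq> carrier A" "finite S" "card S < 4"
  obtains x where "x \<in> carrier A" "x \<notin> span S"
  using gen_ge_dim[of S] assms dim4 span_is_subset2[of S] by force

lemma one_neq_zero: "\<one> \<noteq> \<zero>"
proof
  assume "\<one> = \<zero>"
  then have "x = \<zero>" if "x \<in> carrier A" for x
    using that by (metis l_null l_one)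
  moreover obtain x where "x \<in> carrier A" "x \<notin> span {}"
    using not_spanned[of "{}"] by auto
  ultimately show False using subspaceD(2)[OF span_is_subspace[of "{}"]] by auto
qed

text \<open>An annihilating polynomial of least degree has a linear or quadratic real factor, and
  that factor alone already annihilates \<open>x\<close>.\<close>

lemma quadratic:
  assumes x [simp]: "x \<in> carrier A"
  shows "\<exists>a b. x \<otimes> x = a \<odot> x \<oplus> b \<odot> \<one>"
proof -
  let ?P = "\<lambda>p. p \<noteq> 0 \<and> aeval x p = \<zero>"
  obtain p where p: "?P p" and min: "\<And>q. ?P q \<Longrightarrow> degree p \<le> degree q"
    using ex_has_least_nat[of ?P _ degree] fin_dim_algebraic[OF fin_dim x] by blast
  \<comment> \<open>The cofactor \<open>d\<close> has smaller degree than \<open>p\<close>, so it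
    does not annihilate \<open>x\<close>; without zero divisors the factor \<open>q\<close>
    must.\<close>
  have zero: "aeval x q = \<zero>" if q: "q dvd p" "degree q > 0" for q
  proof -
    obtain d where d: "p = q * d" using q by blast
    then have "degree p = degree q + degree d" "d \<noteq> 0" using p by (auto simp: degree_mult_eq)
    then have "aeval x d \<noteq> \<zero>" using min[of d] q by auto
    then show ?thesis using d p domain[of "aeval x q" "aeval x d"] by (simp add: aeval_mult)
  qed
  have "degree p > 0"
  proof (rule ccontr)
    assume "\<not> degree p > 0"
    then obtain c where "p = [:c:]" by (metis degree_0_id gr0I)
    then show False using p one_neq_zero by (auto simp: scale_eq_zero_iff)
  qed
  from real_poly_has_quadratic_or_linear_factor[OF this] show ?thesis
  proof (elim disjE exE)
    fix c assume "[:- c, 1:] dvd p"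
    from zero[OF this] have "(- c) \<odot> \<one> \<oplus> x = \<zero>" by simp
    then have "x = c \<odot> \<one>" by (simp add: minus_scale) (metis a_comm minus_equality minus_minus scale_closed one_closed x a_inv_closed)
    then have "x \<otimes> x = c \<odot> x \<oplus> 0 \<odot> \<one>" by (simp add: smult_mult_left)
    then show ?thesis by blast
  next
    fix a b assume "[:b, a, 1:] dvd p"
    from zero[OF this] have "b \<odot> \<one> \<oplus> (a \<odot> x \<oplus> x \<otimes> x) = \<zero>"
      by (simp add: r_distr smult_mult_right)
    then have "x \<otimes> x = \<ominus> (a \<odot> x \<oplus> b \<odot> \<one>)"
      by (intro minus_equality[symmetric]) (simp_all add: a_ac)
    then have "x \<otimes> x = (- a) \<odot> x \<oplus> (- b) \<odot> \<one>" by (simp add: minus_add minus_scale)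
    then show ?thesis by blast
  qed
qed

text \<open>For commuting elements the difference of squares factors as
  \<open>(x - y) (x + y)\<close>, and one factor has to vanish.\<close>

lemma square_eqD:
  assumes [simp]: "x \<in> carrier A" "y \<in> carrier A" and "x \<otimes> y = y \<otimes> x" "x \<otimes> x = y \<otimes> y"
  shows "x = y \<or> x = \<ominus> y"
proof -
  have "(x \<ominus> y) \<otimes> (x \<oplus> y) = \<zero>"
    using assms(3,4) by (simp add: a_minus_def l_distr r_distr l_minus a_ac r_neg r_neg1 r_neg2)
  then have "x \<ominus> y = \<zero> \<or> x \<oplus> y = \<zero>" by (intro domain) auto
  then show ?thesis
    by (metis assms(1,2) minus_equality minus_minus a_minus_def a_inv_closed)
qed

lemma square_nonneg:
  assumes x [simp]: "x \<in> carrier A" and "x \<otimes> x = d \<odot> \<one>" "d \<ge> 0"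
  shows "\<exists>r. x = r \<odot> \<one>"
proof -
  have "x = sqrt d \<odot> \<one> \<or> x = \<ominus> (sqrt d \<odot> \<one>)"
    using assms by (intro square_eqD) (simp_all add: smult_mult_left smult_mult_right)
  then show ?thesis by (metis minus_scale one_closed)
qed

lemma square_neg:
  assumes x [simp]: "x \<in> carrier A" and "x \<otimes> x = d \<odot> \<one>" "d < 0"
  shows "((1 / sqrt (- d)) \<odot> x) \<otimes> ((1 / sqrt (- d)) \<odot> x) = \<ominus> \<one>"
proof -
  have "(1 / sqrt (- d)) * (1 / sqrt (- d)) * d = - 1"
    using assms(3) by (simp add: field_simps)
  then show ?thesis using assms by (simp add: smult_mult_left smult_mult_right minus_scale)
qed

lemma imaginary_part:
  assumes x [simp]: "x \<in> carrier A" and nonreal: "\<nexists>r. x = r \<odot> \<one>"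
  shows "\<exists>u r t. u \<in> carrier A \<and> u \<otimes> u = \<ominus> \<one> \<and> t \<noteq> 0 \<and> x = r \<odot> \<one> \<oplus> t \<odot> u"
proof -
  obtain a b where ab: "x \<otimes> x = a \<odot> x \<oplus> b \<odot> \<one>" using quadratic x by blast
  \<comment> \<open>Completing the square removes the linear term of the quadratic equation;
    \<open>d\<close> is a quarter of its discriminant. A nonnegative \<open>d\<close> would make
    \<open>y\<close>, hence \<open>x\<close>, a real scalar.\<close>
  define y where "y = x \<oplus> (- a / 2) \<odot> \<one>"
  define d where "d = b + a\<^sup>2 / 4"
  have y [simp]: "y \<in> carrier A" by (simp add: y_def)
  have xy: "x = (a / 2) \<odot> \<one> \<oplus> y"
    using add_scale[of \<one> "a / 2" "- a / 2"] by (simp add: y_def a_lcomm[of _ x])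
  have "y \<otimes> y = (x \<otimes> x \<oplus> (- a / 2) \<odot> x) \<oplus> ((- a / 2) \<odot> x \<oplus> (a\<^sup>2 / 4) \<odot> \<one>)"
    by (simp add: y_def l_distr r_distr smult_mult_left smult_mult_right scale_add power2_eq_square)
  also have "\<dots> = ((a \<odot> x \<oplus> (- a / 2) \<odot> x) \<oplus> (- a / 2) \<odot> x) \<oplus> (b \<odot> \<one> \<oplus> (a\<^sup>2 / 4) \<odot> \<one>)"
    unfolding ab by (simp add: a_ac)
  also have "\<dots> = d \<odot> \<one>" by (simp add: add_scale[symmetric] d_def)
  finally have yy: "y \<otimes> y = d \<odot> \<one>" .
  have "d < 0"
  proof (rule ccontr)
    assume "\<not> d < 0"
    then obtain r where "y = r \<odot> \<one>" using square_nonneg[OF y yy] by auto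
    then have "x = (a / 2 + r) \<odot> \<one>" using xy by (simp add: add_scale)
    then show False using nonreal by blast
  qed
  let ?u = "(1 / sqrt (- d)) \<odot> y"
  have "?u \<in> carrier A" "?u \<otimes> ?u = \<ominus> \<one>" using square_neg[OF y yy \<open>d < 0\<close>] by auto
  moreover have "x = (a / 2) \<odot> \<one> \<oplus> sqrt (- d) \<odot> ?u" "sqrt (- d) \<noteq> 0" using xy \<open>d < 0\<close> by auto
  ultimately show ?thesis by blast
qed

text \<open>The imaginary unit \<open>u\<close> underlying a non-real \<open>c\<close> commutes with
  \<open>i\<close> and has the same square, so it is \<open>i\<close> or its negative.\<close>

lemma commutes_imaginary_unit:
  assumes i [simp]: "i \<in> carrier A" and ii: "i \<otimes> i = \<ominus> \<one>"
    and c [simp]: "c \<in> carrier A" and ic: "i \<otimes> c = c \<otimes> i"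
  shows "\<exists>r s. c = r \<odot> \<one> \<oplus> s \<odot> i"
proof (cases "\<exists>r. c = r \<odot> \<one>")
  case True
  then obtain r where "c = r \<odot> \<one> \<oplus> 0 \<odot> i" by auto
  then show ?thesis by blast
next
  case False
  then obtain u r t where u [simp]: "u \<in> carrier A" and uu: "u \<otimes> u = \<ominus> \<one>" and t: "t \<noteq> 0"
    and cu: "c = r \<odot> \<one> \<oplus> t \<odot> u" using imaginary_part[OF c] by blast
  have "t \<odot> (i \<otimes> u) = t \<odot> (u \<otimes> i)"
    using ic unfolding cu by (simp add: l_distr r_distr smult_mult_left smult_mult_right)
  then have "(1 / t) \<odot> (t \<odot> (i \<otimes> u)) = (1 / t) \<odot> (t \<odot> (u \<otimes> i))" by simp
  then have "u \<otimes> i = i \<otimes> u" using t by simp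
  then have "u = i \<or> u = \<ominus> i" using ii uu by (intro square_eqD) auto
  then have "c = r \<odot> \<one> \<oplus> t \<odot> i \<or> c = r \<odot> \<one> \<oplus> (- t) \<odot> i"
    unfolding cu by (auto simp: minus_scale)
  then show ?thesis by blast
qed

lemma quaternionic:
  "\<exists>i j. quaternionic_algebra A i j \<and> quaternionic_algebra.cent A i j \<subseteq> range (\<lambda>r. r \<odot> \<one>)"
proof -
  have in_span: "r \<odot> v \<in> span S" if "S \<subseteq> carrier A" "v \<in> S" for r v S
    using subspaceD(4)[OF span_is_subspace[OF that(1)]] in_own_span[OF that(1)] that(2) by blast
  obtain x where x: "x \<in> carrier A" "x \<notin> span {\<one>}"
    using not_spanned[of "{\<one>}"] by auto
  have "\<nexists>r. x = r \<odot> \<one>" using x in_span[of "{\<one>}" \<one>] by auto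
  then obtain i where i [simp]: "i \<in> carrier A" and ii: "i \<otimes> i = \<ominus> \<one>"
    using imaginary_part[OF x(1)] by blast
  have iiz: "i \<otimes> (i \<otimes> z) = \<ominus> z" if "z \<in> carrier A" for z
    using that by (simp add: m_assoc[symmetric] ii l_minus)
  have i0: "i \<noteq> \<zero>" using ii one_neq_zero by (metis l_null i minus_minus minus_zero one_closed)
  have c2: "{\<one>, i} \<subseteq> carrier A" by simp
  obtain y where y [simp]: "y \<in> carrier A" and yn: "y \<notin> span {\<one>, i}"
    by (rule not_spanned[OF c2]) (auto simp: card_insert_if)
  have "r \<odot> \<one> \<oplus> s \<odot> i \<in> span {\<one>, i}" for r s
    using subspaceD(3)[OF span_is_subspace[OF c2] in_span[OF c2] in_span[OF c2]] by simp
  then have y_comm: "i \<otimes> y \<noteq> y \<otimes> i" using commutes_imaginary_unit[OF i ii y] yn by metis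
  \<comment> \<open>Twice the part of \<open>y\<close> that anticommutes with \<open>i\<close>:
    \<open>y\<close> minus its conjugate by \<open>i\<close>.\<close>
  define z where "z = y \<oplus> i \<otimes> y \<otimes> i"
  have z [simp]: "z \<in> carrier A" by (simp add: z_def)
  have zi: "z \<otimes> i = \<ominus> (i \<otimes> z)"
    by (simp add: z_def l_distr r_distr m_assoc ii iiz r_minus minus_add a_comm)
  \<comment> \<open>Multiplying \<open>z\<close> by \<open>i\<close> gives the commutator of
    \<open>i\<close> and \<open>y\<close>, which is nonzero by the choice of
    \<open>y\<close>.\<close>
  have z0: "z \<noteq> \<zero>"
  proof
    assume "z = \<zero>"
    then have "i \<otimes> (y \<oplus> i \<otimes> y \<otimes> i) = \<zero>" by (simp add: z_def)
    then have "i \<otimes> y \<ominus> y \<otimes> i = \<zero>" by (simp add: r_distr m_assoc iiz a_minus_def)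
    then show False using y_comm by simp
  qed
  have iz0: "i \<otimes> z \<noteq> \<zero>" using domain[of i z] i0 z0 by auto
  have self_minus: "w = \<zero>" if "w = \<ominus> w" "w \<in> carrier A" for w
  proof -
    have "2 \<odot> w = w \<oplus> w" using add_scale[of w 1 1] that(2) by simp
    also have "\<dots> = \<zero>" by (subst (2) that(1)) (rule r_neg[OF that(2)])
    finally show ?thesis using that(2) by (simp add: scale_eq_zero_iff)
  qed
  obtain a b where zz: "z \<otimes> z = a \<odot> z \<oplus> b \<odot> \<one>" using quadratic z by blast
  \<comment> \<open>The square of \<open>z\<close> commutes with \<open>i\<close>, whereas
    \<open>a z\<close> anticommutes with it. Comparing both in the quadratic equation of
    \<open>z\<close> forces \<open>a\<close> = 0.\<close>
  have "z \<otimes> z \<otimes> i = i \<otimes> (z \<otimes> z)"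
  proof -
    have "z \<otimes> z \<otimes> i = z \<otimes> \<ominus> (i \<otimes> z)" by (simp add: m_assoc zi)
    also have "\<dots> = \<ominus> (z \<otimes> i) \<otimes> z" by (simp add: m_assoc r_minus l_minus)
    also have "\<dots> = i \<otimes> (z \<otimes> z)" by (simp add: zi m_assoc)
    finally show ?thesis .
  qed
  then have "\<ominus> (a \<odot> (i \<otimes> z)) \<oplus> b \<odot> i = a \<odot> (i \<otimes> z) \<oplus> b \<odot> i"
    unfolding zz by (simp add: l_distr r_distr smult_mult_left smult_mult_right zi)
  then have "\<ominus> (a \<odot> (i \<otimes> z)) = a \<odot> (i \<otimes> z)" by simp
  then have "a \<odot> (i \<otimes> z) = \<zero>" using self_minus[of "a \<odot> (i \<otimes> z)"] by simp
  then have "a = 0" using iz0 by (simp add: scale_eq_zero_iff)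
  then have zz: "z \<otimes> z = b \<odot> \<one>" using zz by simp
  have "b < 0"
  proof (rule ccontr)
    assume "\<not> b < 0"
    then obtain r where "z = r \<odot> \<one>" using square_nonneg[OF z zz] by auto
    then have "z \<otimes> i = i \<otimes> z" by (simp add: smult_mult_left smult_mult_right)
    then show False using zi iz0 self_minus[of "i \<otimes> z"] by simp
  qed
  define j where "j = (1 / sqrt (- b)) \<odot> z"
  interpret Q: quaternionic_algebra A i j
    by unfold_locales
      (simp_all add: j_def ii square_neg[OF z zz \<open>b < 0\<close>] smult_mult_left smult_mult_right zi)
  \<comment> \<open>Commuting with \<open>i\<close> leaves only a real part and a multiple of
    \<open>i\<close>; commuting with \<open>j\<close> as well equates a multiple of \<open>k\<close>
    with its negative and removes the latter.\<close>
  have "c \<in> range (\<lambda>r. r \<odot> \<one>)" if c: "c \<in> Q.cent" for c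
  proof -
    obtain r s where rs: "c = r \<odot> \<one> \<oplus> s \<odot> i"
      using commutes_imaginary_unit[OF i ii, of c] c by (auto simp: Q.cent_commute)
    have "r \<odot> j \<oplus> s \<odot> Q.k = r \<odot> j \<oplus> \<ominus> (s \<odot> Q.k)"
      using Q.cent_commute(2)[OF c] unfolding rs
      by (simp add: l_distr r_distr smult_mult_left smult_mult_right Q.units_mult)
    then have "s \<odot> Q.k = \<ominus> (s \<odot> Q.k)" by simp
    then have "s \<odot> Q.k = \<zero>" using self_minus by simp
    moreover have "Q.k \<noteq> \<zero>" using Q.k_k one_neq_zero
      by (metis Q.k_closed l_null minus_minus minus_zero one_closed)
    ultimately have "s = 0" by (simp add: scale_eq_zero_iff)
    then show ?thesis using rs by auto
  qed
  then show ?thesis using Q.quaternionic_algebra_axioms by blast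
qed

end


section \<open>Quaternionic gradings\<close>

lemma has_dim_1:
  fixes M :: "(real, 'a) module"
  assumes vs: "vectorspace class_ring (M\<lparr>carrier := V\<rparr>)"
    and c: "c \<in> V" "c \<noteq> \<zero>\<^bsub>M\<^esub>" and span: "\<And>y. y \<in> V \<Longrightarrow> \<exists>r. y = r \<odot>\<^bsub>M\<^esub> c"
  shows "has_dim M V 1"
proof -
  let ?V = "M\<lparr>carrier := V\<rparr>"
  interpret V: vectorspace "class_ring :: real ring" ?V by (rule vs)
  have scale: "r \<odot>\<^bsub>M\<^esub> c \<in> V" for r
    using V.smult_closed[of r c] c by simp
  have lc: "V.lincomb a {c} = a c \<odot>\<^bsub>M\<^esub> c" for a
    unfolding V.lincomb_def using scale[of "a c"] V.r_zero[of "a c \<odot>\<^bsub>M\<^esub> c"] by (subst V.finsum_insert) auto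
  have "V.lin_indpt {c}"
  proof (rule V.finite_lin_indpt2)
    fix a :: "'a \<Rightarrow> real"
    assume "V.lincomb a {c} = \<zero>\<^bsub>?V\<^esub>"
    then have *: "a c \<odot>\<^bsub>M\<^esub> c = \<zero>\<^bsub>M\<^esub>" unfolding lc by simp
    have "a c = 0"
    proof (rule ccontr)
      assume "a c \<noteq> 0"
      then have "c = (1 / a c) \<odot>\<^bsub>M\<^esub> (a c \<odot>\<^bsub>M\<^esub> c)"
        using V.smult_assoc1[of "1 / a c" "a c" c] V.smult_one[of c] c by simp
      then show False using * V.smult_r_null[of "1 / a c"] c by simp
    qed
    then show "\<forall>v\<in>{c}. a v = \<zero>\<^bsub>class_ring\<^esub>" by simp
  qed (use c in auto)
  moreover have "V.span {c} = carrier ?V"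
  proof
    show "V.span {c} \<subseteq> carrier ?V" using V.span_is_subset2[of "{c}"] c by simp
    show "carrier ?V \<subseteq> V.span {c}"
    proof
      fix y assume "y \<in> carrier ?V"
      then obtain r where "y = r \<odot>\<^bsub>M\<^esub> c" using span by auto
      then have "y = V.lincomb (\<lambda>_. r) {c}" unfolding lc .
      then show "y \<in> V.span {c}" unfolding V.span_def by auto
    qed
  qed
  ultimately have "V.basis {c}" using c by (simp add: V.basis_def)
  then have "V.fin_dim" "V.dim = card {c}"
    using V.dim_basis[of "{c}"] by (auto simp: V.fin_dim_def V.basis_def)
  then show ?thesis by (simp add: has_dim_def)
qed

locale quaternionic_graded_algebra = graded_algebra G A \<Gamma> + quaternionic_algebra A i j
  for G (structure) and A :: "(real, 'a) module" (structure) and \<Gamma> i j +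
  assumes i_neutral: "i \<in> \<Gamma> \<one>\<^bsub>G\<^esub>" and j_neutral: "j \<in> \<Gamma> \<one>\<^bsub>G\<^esub>"
    and neutral_cent: "\<lbrakk>c \<in> cent; c \<in> \<Gamma> \<one>\<^bsub>G\<^esub>\<rbrakk> \<Longrightarrow> \<exists>r. c = r \<odot>\<^bsub>A\<^esub> \<one>\<^bsub>A\<^esub>"
begin

lemma k_neutral: "k \<in> \<Gamma> \<one>\<^bsub>G\<^esub>"
  using component_mult[OF _ _ i_neutral j_neutral] by (simp add: k_def)

lemma neutral_mult:
  assumes "g \<in> carrier G" "x \<in> \<Gamma> g" "y \<in> \<Gamma> \<one>\<^bsub>G\<^esub>"
  shows "x \<otimes>\<^bsub>A\<^esub> y \<in> \<Gamma> g" "y \<otimes>\<^bsub>A\<^esub> x \<in> \<Gamma> g"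
  using component_mult[of g "\<one>\<^bsub>G\<^esub>" x y] component_mult[of "\<one>\<^bsub>G\<^esub>" g y x] assms by auto

lemma avg_component: "\<lbrakk>g \<in> carrier G; x \<in> \<Gamma> g\<rbrakk> \<Longrightarrow> avg x \<in> \<Gamma> g"
  unfolding avg_def a_minus_def
  by (intro subspaceD(3-5)[OF component_subspace] neutral_mult i_neutral j_neutral k_neutral)

lemma coords_component:
  assumes "g \<in> carrier G" "x \<in> \<Gamma> g"
  shows "avg x \<in> \<Gamma> g" "avg (\<ominus>\<^bsub>A\<^esub> (x \<otimes>\<^bsub>A\<^esub> i)) \<in> \<Gamma> g" "avg (\<ominus>\<^bsub>A\<^esub> (x \<otimes>\<^bsub>A\<^esub> j)) \<in> \<Gamma> g"
    "avg (\<ominus>\<^bsub>A\<^esub> (x \<otimes>\<^bsub>A\<^esub> k)) \<in> \<Gamma> g"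
  using assms
  by (intro avg_component subspaceD(5)[OF component_subspace] neutral_mult i_neutral j_neutral k_neutral; simp)+

lemma quad_component:
  assumes g: "g \<in> carrier G" and "a \<in> \<Gamma> g" "b \<in> \<Gamma> g" "c \<in> \<Gamma> g" "d \<in> \<Gamma> g"
  shows "quad a b c d \<in> \<Gamma> g"
  unfolding quad_def using assms
  by (intro subspaceD(3)[OF component_subspace] neutral_mult i_neutral j_neutral k_neutral)

lemma quad_cases:
  assumes "x \<in> carrier A"
  obtains a b c d where "a \<in> cent" "b \<in> cent" "c \<in> cent" "d \<in> cent" "x = quad a b c d"
  by (rule that[OF _ _ _ _ quad_avg[OF assms]]) (use assms in \<open>auto intro!: avg_cent\<close>)

lemma component_quad_cases:
  assumes "g \<in> carrier G" "x \<in> \<Gamma> g"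
  obtains a b c d where "a \<in> cent \<inter> \<Gamma> g" "b \<in> cent \<inter> \<Gamma> g" "c \<in> cent \<inter> \<Gamma> g" "d \<in> cent \<inter> \<Gamma> g"
    "x = quad a b c d"
proof -
  have x: "x \<in> carrier A" using assms component_closed by blast
  show ?thesis
    by (rule that[OF _ _ _ _ quad_avg[OF x]])
      (use coords_component[OF assms] x in \<open>auto intro!: avg_cent\<close>)
qed

text \<open>A neutral element has real coordinates with respect to 1, \<open>i\<close>,
  \<open>j\<close>, \<open>k\<close>, so commuting with \<open>i\<close> and \<open>j\<close>
  suffices.\<close>

lemma centralizer_carrier: "carrier (neutral_centralizer G A \<Gamma>) = cent"
proof (intro equalityI subsetI)
  fix c assume "c \<in> carrier (neutral_centralizer G A \<Gamma>)"
  then show "c \<in> cent"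
    using i_neutral j_neutral unfolding cent_def neutral_centralizer_carrier by blast
next
  fix c assume c: "c \<in> cent"
  have "c \<otimes>\<^bsub>A\<^esub> y = y \<otimes>\<^bsub>A\<^esub> c" if y: "y \<in> \<Gamma> \<one>\<^bsub>G\<^esub>" for y
  proof -
    obtain a1 a2 a3 a4 where a: "a1 \<in> cent \<inter> \<Gamma> \<one>\<^bsub>G\<^esub>" "a2 \<in> cent \<inter> \<Gamma> \<one>\<^bsub>G\<^esub>" "a3 \<in> cent \<inter> \<Gamma> \<one>\<^bsub>G\<^esub>"
      "a4 \<in> cent \<inter> \<Gamma> \<one>\<^bsub>G\<^esub>" and y_eq: "y = quad a1 a2 a3 a4"
      by (rule component_quad_cases[OF _ y]) simp
    from a[THEN IntD1] a[THEN IntD2] obtain p q r s where y': "y = quad (p \<odot>\<^bsub>A\<^esub> \<one>\<^bsub>A\<^esub>) (q \<odot>\<^bsub>A\<^esub> \<one>\<^bsub>A\<^esub>) (r \<odot>\<^bsub>A\<^esub> \<one>\<^bsub>A\<^esub>) (s \<odot>\<^bsub>A\<^esub> \<one>\<^bsub>A\<^esub>)"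
      unfolding y_eq using neutral_cent by metis
    show ?thesis unfolding y' quad_def using c
      by (simp add: l_distr r_distr smult_mult_left smult_mult_right cent_commute)
  qed
  then show "c \<in> carrier (neutral_centralizer G A \<Gamma>)"
    using c unfolding neutral_centralizer_carrier by simp
qed

lemma centralizer_grading_eq: "centralizer_grading G A \<Gamma> g = cent \<inter> \<Gamma> g"
  by (simp add: centralizer_grading_def centralizer_carrier)

lemma neutral_centralizer_eq: "neutral_centralizer G A \<Gamma> = A\<lparr>carrier := cent\<rparr>"
  using centralizer_carrier by (simp add: neutral_centralizer_def)

end

context graded_division_algebra
begin

text \<open>Any nonzero \<open>c\<close> of degree \<open>g\<close> in the centralizer spans its
  component: for \<open>y\<close> in the same component, the inverse of \<open>c\<close> times
  \<open>y\<close> is neutral and lies in \<open>cent\<close>, hence is a real scalar.\<close>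

lemma centralizer_has_dim_1:
  assumes "quaternionic_graded_algebra G A \<Gamma> i j"
    and g: "g \<in> grading_support G (neutral_centralizer G A \<Gamma>) (centralizer_grading G A \<Gamma>)"
  shows "has_dim (neutral_centralizer G A \<Gamma>) (centralizer_grading G A \<Gamma> g) 1"
proof -
  interpret Q: quaternionic_graded_algebra G A \<Gamma> i j by fact
  interpret C: graded_algebra G "neutral_centralizer G A \<Gamma>" "centralizer_grading G A \<Gamma>"
    by (rule graded_centralizer)
  have gG: "g \<in> carrier G" using g by (simp add: grading_support_def)
  then obtain c where c: "c \<in> Q.cent" "c \<in> \<Gamma> g" "c \<noteq> \<zero>\<^bsub>A\<^esub>"
    using g C.component_zero[OF gG]
    by (auto simp: grading_support_def Q.centralizer_grading_eq Q.neutral_centralizer_eq)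
  have u: "c \<in> Units A" using homogeneous_invertible[OF gG] c by blast
  have "\<exists>r. y = r \<odot>\<^bsub>A\<^esub> c" if y: "y \<in> Q.cent" "y \<in> \<Gamma> g" for y
  proof -
    have cl: "c \<in> carrier A" "y \<in> carrier A" "inv\<^bsub>A\<^esub> c \<in> carrier A" using c y u by auto
    have "inv\<^bsub>A\<^esub> c \<in> Q.cent"
      using c(1) cl inv_commute[OF u] by (simp add: Q.cent_def del: Q.cent_closed)
    moreover have "inv\<^bsub>A\<^esub> c \<otimes>\<^bsub>A\<^esub> y \<in> \<Gamma> \<one>\<^bsub>G\<^esub>"
      using component_mult[OF _ gG inv_homogeneous[OF gG c(2) u] y(2)] gG by simp
    ultimately obtain r where "inv\<^bsub>A\<^esub> c \<otimes>\<^bsub>A\<^esub> y = r \<odot>\<^bsub>A\<^esub> \<one>\<^bsub>A\<^esub>"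
      using Q.neutral_cent Q.cent_mult y(1) by blast
    then have "c \<otimes>\<^bsub>A\<^esub> (inv\<^bsub>A\<^esub> c \<otimes>\<^bsub>A\<^esub> y) = r \<odot>\<^bsub>A\<^esub> c" using cl by (simp add: smult_mult_right)
    then show ?thesis using cl u by (metis Units_r_inv l_one m_assoc)
  qed
  then show ?thesis
    using c C.subspace_is_vs[OF C.component_subspace[OF gG]]
    by (intro has_dim_1) (auto simp: Q.centralizer_grading_eq Q.neutral_centralizer_eq)
qed

lemma neutral_quaternionic:
  assumes dim4: "\<forall>g \<in> grading_support G A \<Gamma>. has_dim A (\<Gamma> g) 4"
  obtains i j where "quaternionic_graded_algebra G A \<Gamma> i j"
proof (cases "\<one>\<^bsub>A\<^esub> = \<zero>\<^bsub>A\<^esub>")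
  \<comment> \<open>The zero algebra has empty support, so \<open>dim4\<close> says nothing; there \<open>i = j = 0\<close> satisfy all relations.\<close>
  case True
  have zero: "x = \<zero>\<^bsub>A\<^esub>" if "x \<in> carrier A" for x using True that by (metis l_null l_one)
  have Q: "quaternionic_algebra A \<zero>\<^bsub>A\<^esub> \<zero>\<^bsub>A\<^esub>"
    using True by unfold_locales auto
  have "quaternionic_graded_algebra G A \<Gamma> \<zero>\<^bsub>A\<^esub> \<zero>\<^bsub>A\<^esub>"
  proof (intro quaternionic_graded_algebra.intro quaternionic_graded_algebra_axioms.intro Q)
    show "\<exists>r. c = r \<odot>\<^bsub>A\<^esub> \<one>\<^bsub>A\<^esub>" if "c \<in> \<Gamma> \<one>\<^bsub>G\<^esub>" for c
      using zero[of c] component_closed[OF _ that] True by simp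
  qed (simp_all add: graded_algebra_axioms)
  then show ?thesis by (rule that)
next
  case False
  let ?B = "A\<lparr>carrier := \<Gamma> \<one>\<^bsub>G\<^esub>\<rparr>"
  have "\<one>\<^bsub>G\<^esub> \<in> grading_support G A \<Gamma>"
    using one_neutral False by (auto simp: grading_support_def)
  then have dim: "has_dim A (\<Gamma> \<one>\<^bsub>G\<^esub>) 4" using dim4 by blast
  have one_G: "\<one>\<^bsub>G\<^esub> \<in> carrier G" by simp
  note sub = component_subspace[OF one_G]
  note sub' = subspaceD[OF sub]
  have "x \<otimes>\<^bsub>A\<^esub> y \<in> \<Gamma> \<one>\<^bsub>G\<^esub>" if "x \<in> \<Gamma> \<one>\<^bsub>G\<^esub>" "y \<in> \<Gamma> \<one>\<^bsub>G\<^esub>" for x y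
    using component_mult[OF one_G one_G that] by simp
  then interpret B: unital_real_algebra ?B
    by (intro subalgebra_is_algebra sub one_neutral)
  interpret B: real_division_algebra4 ?B
  proof
    show "B.fin_dim" "B.dim = 4" using dim by (auto simp: has_dim_def)
    fix x y assume xy: "x \<in> carrier ?B" "y \<in> carrier ?B" "x \<otimes>\<^bsub>?B\<^esub> y = \<zero>\<^bsub>?B\<^esub>"
    \<comment> \<open>The inverse of \<open>x\<close> can be taken in the whole algebra, since it
      serves only for cancellation.\<close>
    show "x = \<zero>\<^bsub>?B\<^esub> \<or> y = \<zero>\<^bsub>?B\<^esub>"
    proof (cases "x = \<zero>\<^bsub>A\<^esub>")
      case False
      then have u: "x \<in> Units A" using homogeneous_invertible[OF one_G] xy by auto
      have y: "y \<in> carrier A" using xy(2) sub'(1) by auto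
      have "inv\<^bsub>A\<^esub> x \<otimes>\<^bsub>A\<^esub> x \<otimes>\<^bsub>A\<^esub> y = inv\<^bsub>A\<^esub> x \<otimes>\<^bsub>A\<^esub> (x \<otimes>\<^bsub>A\<^esub> y)"
        using u y by (intro m_assoc) auto
      then show ?thesis using xy(3) u y by simp
    qed simp
  qed
  obtain i j where "quaternionic_algebra ?B i j" and
    c: "quaternionic_algebra.cent ?B i j \<subseteq> range (\<lambda>r. r \<odot>\<^bsub>?B\<^esub> \<one>\<^bsub>?B\<^esub>)"
    using B.quaternionic by blast
  then interpret QB: quaternionic_algebra ?B i j by blast
  \<comment> \<open>Negation refers to the carrier of its record, so the two negations are compared
    through multiplication by the scalar -1, which both records share.\<close>
  have minus: "\<ominus>\<^bsub>?B\<^esub> x = \<ominus>\<^bsub>A\<^esub> x" if "x \<in> \<Gamma> \<one>\<^bsub>G\<^esub>" for x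
    using B.minus_scale[of x 1] minus_scale[of x 1] that sub'(1) by auto
  have ij: "i \<in> \<Gamma> \<one>\<^bsub>G\<^esub>" "j \<in> \<Gamma> \<one>\<^bsub>G\<^esub>" using QB.i_closed QB.j_closed by auto
  interpret Q: quaternionic_algebra A i j
  proof
    show "i \<otimes>\<^bsub>A\<^esub> i = \<ominus>\<^bsub>A\<^esub> \<one>\<^bsub>A\<^esub>" "j \<otimes>\<^bsub>A\<^esub> j = \<ominus>\<^bsub>A\<^esub> \<one>\<^bsub>A\<^esub>"
      using QB.i_i QB.j_j minus[OF one_neutral] by auto
    show "j \<otimes>\<^bsub>A\<^esub> i = \<ominus>\<^bsub>A\<^esub> (i \<otimes>\<^bsub>A\<^esub> j)"
      using QB.j_i minus[of "i \<otimes>\<^bsub>A\<^esub> j"] component_mult[OF one_G one_G ij] by simp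
  qed (use ij sub'(1) in auto)
  have "quaternionic_graded_algebra G A \<Gamma> i j"
  proof (intro quaternionic_graded_algebra.intro quaternionic_graded_algebra_axioms.intro)
    show "\<exists>r. c = r \<odot>\<^bsub>A\<^esub> \<one>\<^bsub>A\<^esub>" if "c \<in> Q.cent" "c \<in> \<Gamma> \<one>\<^bsub>G\<^esub>" for c
    proof -
      have "c \<in> QB.cent" using that by (simp add: Q.cent_def QB.cent_def del: Q.cent_closed QB.cent_closed)
      then show ?thesis using c by auto
    qed
  qed (simp_all add: graded_algebra_axioms Q.quaternionic_algebra_axioms ij)
  then show ?thesis by (rule that)
qed

end


section \<open>Extending isomorphisms of centralizers\<close>

lemma algebra_isoD:
  assumes "\<phi> \<in> algebra_iso A B"
  shows "bij_betw \<phi> (carrier A) (carrier B)"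
    and "x \<in> carrier A \<Longrightarrow> \<phi> x \<in> carrier B"
    and "\<phi> \<one>\<^bsub>A\<^esub> = \<one>\<^bsub>B\<^esub>"
    and "\<lbrakk>x \<in> carrier A; y \<in> carrier A\<rbrakk> \<Longrightarrow> \<phi> (x \<otimes>\<^bsub>A\<^esub> y) = \<phi> x \<otimes>\<^bsub>B\<^esub> \<phi> y"
    and "\<lbrakk>x \<in> carrier A; y \<in> carrier A\<rbrakk> \<Longrightarrow> \<phi> (x \<oplus>\<^bsub>A\<^esub> y) = \<phi> x \<oplus>\<^bsub>B\<^esub> \<phi> y"
    and "x \<in> carrier A \<Longrightarrow> \<phi> (r \<odot>\<^bsub>A\<^esub> x) = r \<odot>\<^bsub>B\<^esub> \<phi> x"
  using assms by (auto simp: algebra_iso_def ring_iso_def Ring.ring_hom_def)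

lemma algebra_isoI:
  assumes "bij_betw \<phi> (carrier A) (carrier B)" and "\<phi> \<one>\<^bsub>A\<^esub> = \<one>\<^bsub>B\<^esub>"
    and "\<And>x y. \<lbrakk>x \<in> carrier A; y \<in> carrier A\<rbrakk> \<Longrightarrow> \<phi> (x \<otimes>\<^bsub>A\<^esub> y) = \<phi> x \<otimes>\<^bsub>B\<^esub> \<phi> y"
    and "\<And>x y. \<lbrakk>x \<in> carrier A; y \<in> carrier A\<rbrakk> \<Longrightarrow> \<phi> (x \<oplus>\<^bsub>A\<^esub> y) = \<phi> x \<oplus>\<^bsub>B\<^esub> \<phi> y"
    and "\<And>r x. x \<in> carrier A \<Longrightarrow> \<phi> (r \<odot>\<^bsub>A\<^esub> x) = r \<odot>\<^bsub>B\<^esub> \<phi> x"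
  shows "\<phi> \<in> algebra_iso A B"
  using assms bij_betwE[OF assms(1)] by (auto simp: algebra_iso_def ring_iso_def Ring.ring_hom_def)

text \<open>The map applies \<open>\<phi>\<close> to each coordinate. It is multiplicative because
  Hamilton's formula expresses coordinates of a product by operations inside the centralizers.
  Degrees \<open>g\<close> and \<open>h\<close> may belong to different groups, so one extension
  serves both isomorphism and equivalence.\<close>

lemma extend_centralizer_iso:
  assumes "quaternionic_graded_algebra G A \<Gamma> i j" and "quaternionic_graded_algebra H B \<Delta> i' j'"
    and \<phi>: "\<phi> \<in> algebra_iso (neutral_centralizer G A \<Gamma>) (neutral_centralizer H B \<Delta>)"
  obtains \<psi> where "\<psi> \<in> algebra_iso A B"
    and "\<And>g h. \<lbrakk>g \<in> carrier G; h \<in> carrier H;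
      \<phi> ` centralizer_grading G A \<Gamma> g = centralizer_grading H B \<Delta> h\<rbrakk> \<Longrightarrow> \<psi> ` \<Gamma> g = \<Delta> h"
proof -
  interpret S: quaternionic_graded_algebra G A \<Gamma> i j by fact
  interpret T: quaternionic_graded_algebra H B \<Delta> i' j' by fact
  \<comment> \<open>Reading the coordinates off with \<open>avg\<close> avoids choosing them;
    \<open>quad_coords\<close> then gives the rule on explicit quadruples.\<close>
  define \<psi> where "\<psi> x = T.quad (\<phi> (S.avg x)) (\<phi> (S.avg (\<ominus>\<^bsub>A\<^esub> (x \<otimes>\<^bsub>A\<^esub> i))))
    (\<phi> (S.avg (\<ominus>\<^bsub>A\<^esub> (x \<otimes>\<^bsub>A\<^esub> j)))) (\<phi> (S.avg (\<ominus>\<^bsub>A\<^esub> (x \<otimes>\<^bsub>A\<^esub> S.k))))" for x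
  note \<phi>' = algebra_isoD[OF \<phi>, unfolded S.neutral_centralizer_eq T.neutral_centralizer_eq, simplified]
  have \<phi>_minus: "\<phi> (x \<ominus>\<^bsub>A\<^esub> y) = \<phi> x \<ominus>\<^bsub>B\<^esub> \<phi> y" if "x \<in> S.cent" "y \<in> S.cent" for x y
  proof -
    have "x \<ominus>\<^bsub>A\<^esub> y = x \<oplus>\<^bsub>A\<^esub> (- 1) \<odot>\<^bsub>A\<^esub> y" using that by (simp add: a_minus_def S.minus_scale)
    then show ?thesis using that by (simp add: \<phi>' S.centI a_minus_def T.minus_scale)
  qed
  have \<psi>: "\<psi> (S.quad a b c d) = T.quad (\<phi> a) (\<phi> b) (\<phi> c) (\<phi> d)"
    if "a \<in> S.cent" "b \<in> S.cent" "c \<in> S.cent" "d \<in> S.cent" for a b c d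
    unfolding \<psi>_def using that by (simp add: S.quad_coords)
  have \<phi>_surj: "\<exists>a. a \<in> S.cent \<and> \<phi> a = a'" if "a' \<in> T.cent" for a'
    using that unfolding bij_betw_imp_surj_on[OF \<phi>'(1), symmetric] by auto
  have \<phi>_inj: "\<phi> a = \<phi> b \<longleftrightarrow> a = b" if "a \<in> S.cent" "b \<in> S.cent" for a b
    using inj_on_eq_iff[OF bij_betw_imp_inj_on[OF \<phi>'(1)] that] .
  have closed: "\<psi> x \<in> carrier B" if "x \<in> carrier A" for x
    using that by (elim S.quad_cases) (simp add: \<psi> \<phi>')
  have "\<psi> \<in> algebra_iso A B"
  proof (rule algebra_isoI)
    have "inj_on \<psi> (carrier A)"
    proof (rule inj_onI)
      fix x y assume "x \<in> carrier A" "y \<in> carrier A" and eq: "\<psi> x = \<psi> y"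
      then show "x = y"
        by (elim S.quad_cases) (simp add: \<psi> \<phi>' T.quad_eq_iff \<phi>_inj)
    qed
    moreover have "y \<in> \<psi> ` carrier A" if yB: "y \<in> carrier B" for y
    proof -
      obtain a' b' c' d' where y: "a' \<in> T.cent" "b' \<in> T.cent" "c' \<in> T.cent" "d' \<in> T.cent"
        "y = T.quad a' b' c' d'" by (rule T.quad_cases[OF yB])
      obtain a b c d where "a \<in> S.cent" "b \<in> S.cent" "c \<in> S.cent" "d \<in> S.cent"
        "\<phi> a = a'" "\<phi> b = b'" "\<phi> c = c'" "\<phi> d = d'"
        using y(1-4)[THEN \<phi>_surj] by blast
      then show ?thesis using y(5) by (intro image_eqI[of _ _ "S.quad a b c d"]) (simp_all add: \<psi>)
    qed
    ultimately show "bij_betw \<psi> (carrier A) (carrier B)"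
      using closed by (auto simp: bij_betw_def)
    have zero: "\<phi> \<zero>\<^bsub>A\<^esub> = \<zero>\<^bsub>B\<^esub>"
      using \<phi>'(6)[of "\<zero>\<^bsub>A\<^esub>" 0] \<phi>'(2)[of "\<zero>\<^bsub>A\<^esub>"] S.centI(1) by simp
    have "\<one>\<^bsub>A\<^esub> = S.quad \<one>\<^bsub>A\<^esub> \<zero>\<^bsub>A\<^esub> \<zero>\<^bsub>A\<^esub> \<zero>\<^bsub>A\<^esub>" by (simp add: S.quad_def)
    also have "\<psi> \<dots> = \<one>\<^bsub>B\<^esub>"
      by (subst \<psi>) (simp_all add: S.cent_one S.centI(1) zero \<phi>' T.quad_def)
    finally show "\<psi> \<one>\<^bsub>A\<^esub> = \<one>\<^bsub>B\<^esub>" .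
    fix x y r assume x: "x \<in> carrier A"
    obtain a b c d where abcd: "a \<in> S.cent" "b \<in> S.cent" "c \<in> S.cent" "d \<in> S.cent"
      and x': "x = S.quad a b c d" by (rule S.quad_cases[OF x])
    show "\<psi> (r \<odot>\<^bsub>A\<^esub> x) = r \<odot>\<^bsub>B\<^esub> \<psi> x"
      using abcd unfolding x' by (simp add: S.quad_scale T.quad_scale \<psi> \<phi>' S.centI)
    assume y: "y \<in> carrier A"
    obtain a' b' c' d' where abcd': "a' \<in> S.cent" "b' \<in> S.cent" "c' \<in> S.cent" "d' \<in> S.cent"
      and y': "y = S.quad a' b' c' d'" by (rule S.quad_cases[OF y])
    show "\<psi> (x \<oplus>\<^bsub>A\<^esub> y) = \<psi> x \<oplus>\<^bsub>B\<^esub> \<psi> y"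
      using abcd abcd' unfolding x' y' by (simp add: S.quad_add T.quad_add \<psi> \<phi>' S.centI)
    show "\<psi> (x \<otimes>\<^bsub>A\<^esub> y) = \<psi> x \<otimes>\<^bsub>B\<^esub> \<psi> y"
      using abcd abcd' unfolding x' y'
      by (simp add: S.quad_mult T.quad_mult \<psi> \<phi>' \<phi>_minus S.centI S.cent_mult S.cent_minus)
  qed
  moreover have "\<psi> ` \<Gamma> g = \<Delta> h" if g: "g \<in> carrier G" and h: "h \<in> carrier H"
    and eq: "\<phi> ` centralizer_grading G A \<Gamma> g = centralizer_grading H B \<Delta> h" for g h
  proof (intro equalityI subsetI)
    note eq' = eq[unfolded S.centralizer_grading_eq T.centralizer_grading_eq]
    { fix y assume "y \<in> \<psi> ` \<Gamma> g"
      then obtain x where x: "x \<in> \<Gamma> g" "y = \<psi> x" by blast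
      obtain a b c d where "a \<in> S.cent \<inter> \<Gamma> g" "b \<in> S.cent \<inter> \<Gamma> g" "c \<in> S.cent \<inter> \<Gamma> g"
        "d \<in> S.cent \<inter> \<Gamma> g" "x = S.quad a b c d" by (rule S.component_quad_cases[OF g x(1)])
      then have "y = T.quad (\<phi> a) (\<phi> b) (\<phi> c) (\<phi> d)"
        "\<phi> a \<in> \<Delta> h" "\<phi> b \<in> \<Delta> h" "\<phi> c \<in> \<Delta> h" "\<phi> d \<in> \<Delta> h" using eq' x(2) \<psi> by auto
      then show "y \<in> \<Delta> h" using T.quad_component[OF h] by simp }
    fix y assume "y \<in> \<Delta> h"
    obtain a' b' c' d' where y: "a' \<in> T.cent \<inter> \<Delta> h" "b' \<in> T.cent \<inter> \<Delta> h" "c' \<in> T.cent \<inter> \<Delta> h"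
      "d' \<in> T.cent \<inter> \<Delta> h" "y = T.quad a' b' c' d'" by (rule T.component_quad_cases[OF h \<open>y \<in> \<Delta> h\<close>])
    obtain a b c d where "a \<in> S.cent \<inter> \<Gamma> g" "b \<in> S.cent \<inter> \<Gamma> g" "c \<in> S.cent \<inter> \<Gamma> g"
      "d \<in> S.cent \<inter> \<Gamma> g" "a' = \<phi> a" "b' = \<phi> b" "c' = \<phi> c" "d' = \<phi> d"
      using y(1-4) unfolding eq'[symmetric] by blast
    then show "y \<in> \<psi> ` \<Gamma> g"
      using y(5) S.quad_component[OF g, of a b c d] by (intro image_eqI[of _ _ "S.quad a b c d"]) (simp_all add: \<psi>)
  qed
  ultimately show ?thesis by (rule that)
qed

lemma graded_isomorphic_of_centralizers:
  assumes "quaternionic_graded_algebra G A \<Gamma> i j" and "quaternionic_graded_algebra G B \<Delta> i' j'"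
    and "graded_isomorphic G (neutral_centralizer G A \<Gamma>) (centralizer_grading G A \<Gamma>)
      (neutral_centralizer G B \<Delta>) (centralizer_grading G B \<Delta>)"
  shows "graded_isomorphic G A \<Gamma> B \<Delta>"
proof -
  obtain \<phi> where \<phi>: "\<phi> \<in> algebra_iso (neutral_centralizer G A \<Gamma>) (neutral_centralizer G B \<Delta>)"
    "\<forall>g\<in>carrier G. \<phi> ` centralizer_grading G A \<Gamma> g = centralizer_grading G B \<Delta> g"
    using assms(3) unfolding graded_isomorphic_def by blast
  from extend_centralizer_iso[OF assms(1,2) \<phi>(1)] show ?thesis
    unfolding graded_isomorphic_def using \<phi>(2) by metis
qed

lemma graded_equivalent_of_centralizers:
  assumes "quaternionic_graded_algebra G A \<Gamma> i j" and "quaternionic_graded_algebra H B \<Delta> i' j'"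
    and "graded_equivalent G (neutral_centralizer G A \<Gamma>) (centralizer_grading G A \<Gamma>)
      H (neutral_centralizer H B \<Delta>) (centralizer_grading H B \<Delta>)"
  shows "graded_equivalent G A \<Gamma> H B \<Delta>"
proof -
  interpret S: quaternionic_graded_algebra G A \<Gamma> i j by fact
  obtain \<phi> where \<phi>: "\<phi> \<in> algebra_iso (neutral_centralizer G A \<Gamma>) (neutral_centralizer H B \<Delta>)"
    "\<forall>g\<in>grading_support G (neutral_centralizer G A \<Gamma>) (centralizer_grading G A \<Gamma>).
      \<exists>h\<in>carrier H. \<phi> ` centralizer_grading G A \<Gamma> g = centralizer_grading H B \<Delta> h"
    using assms(3) unfolding graded_equivalent_def by blast
  obtain \<psi> where \<psi>: "\<psi> \<in> algebra_iso A B"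
    "\<And>g h. \<lbrakk>g \<in> carrier G; h \<in> carrier H;
      \<phi> ` centralizer_grading G A \<Gamma> g = centralizer_grading H B \<Delta> h\<rbrakk> \<Longrightarrow> \<psi> ` \<Gamma> g = \<Delta> h"
    by (rule extend_centralizer_iso[OF assms(1,2) \<phi>(1)]) blast
  \<comment> \<open>The given map is controlled only on the support of the centralizer, so the
    support of \<open>A\<close> must lie inside it. If the centralizer has only zero in degree
    \<open>g\<close>, all four coordinates of an element of degree \<open>g\<close> vanish.\<close>
  have "g \<in> grading_support G (neutral_centralizer G A \<Gamma>) (centralizer_grading G A \<Gamma>)"
    if "g \<in> grading_support G A \<Gamma>" for g
  proof (rule ccontr)
    have g: "g \<in> carrier G" "\<Gamma> g \<noteq> {\<zero>\<^bsub>A\<^esub>}" using that by (auto simp: grading_support_def)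
    assume "\<not> ?thesis"
    then have zero: "S.cent \<inter> \<Gamma> g = {\<zero>\<^bsub>A\<^esub>}"
      using g by (simp add: grading_support_def S.centralizer_grading_eq S.neutral_centralizer_eq)
    have "x = \<zero>\<^bsub>A\<^esub>" if "x \<in> \<Gamma> g" for x
      by (rule S.component_quad_cases[OF g(1) that]) (simp add: zero S.quad_def)
    then show False using g S.component_zero[OF g(1)] by blast
  qed
  then have "\<exists>h\<in>carrier H. \<psi> ` \<Gamma> g = \<Delta> h" if "g \<in> grading_support G A \<Gamma>" for g
    using that \<phi>(2) \<psi>(2)[of g] by (metis (no_types, lifting) grading_support_def mem_Collect_eq)
  then show ?thesis
    unfolding graded_equivalent_def using \<psi>(1) by blast
qed


section \<open>The tensor decomposition\<close>

abbreviation free_gen :: "'a \<Rightarrow> 'b \<Rightarrow> 'a \<times> 'b \<Rightarrow> real" where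
  "free_gen a b \<equiv> indicator {(a, b)}"

lemma free_algebra_sel [simp]:
  "zero (free_algebra M N) = (\<lambda>_. 0)"
  "add (free_algebra M N) = (\<lambda>f h p. f p + h p)"
  "(\<odot>\<^bsub>free_algebra M N\<^esub>) = (\<lambda>r f p. r * f p)"
  "one (free_algebra M N) = free_gen \<one>\<^bsub>M\<^esub> \<one>\<^bsub>N\<^esub>"
  by (simp_all add: free_algebra_def)

lemma free_algebra_carrier:
  "f \<in> carrier (free_algebra M N) \<longleftrightarrow> finite {p. f p \<noteq> 0} \<and> {p. f p \<noteq> 0} \<subseteq> carrier M \<times> carrier N"
  by (simp add: free_algebra_def)

lemma free_algebra_zero: "(\<lambda>_. 0) \<in> carrier (free_algebra M N)"
  by (simp add: free_algebra_carrier)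

lemma free_algebra_add:
  assumes "f \<in> carrier (free_algebra M N)" "h \<in> carrier (free_algebra M N)"
  shows "(\<lambda>p. f p + h p) \<in> carrier (free_algebra M N)"
proof -
  have "{p. f p + h p \<noteq> 0} \<subseteq> {p. f p \<noteq> 0} \<union> {p. h p \<noteq> 0}" by auto
  then show ?thesis using assms unfolding free_algebra_carrier
    by (meson finite_UnI finite_subset le_sup_iff order_trans)
qed

lemma free_algebra_scale:
  assumes "f \<in> carrier (free_algebra M N)"
  shows "(\<lambda>p. r * f p) \<in> carrier (free_algebra M N)"
proof -
  have "{p. r * f p \<noteq> 0} \<subseteq> {p. f p \<noteq> 0}" by auto
  then show ?thesis using assms unfolding free_algebra_carrier
    by (meson finite_subset order_trans)
qed

lemma free_algebra_diff:
  assumes "f \<in> carrier (free_algebra M N)" "h \<in> carrier (free_algebra M N)"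
  shows "(\<lambda>p. f p - h p) \<in> carrier (free_algebra M N)"
  using free_algebra_add[OF assms(1) free_algebra_scale[OF assms(2), of "- 1"]] by simp

lemma free_algebra_gen:
  "\<lbrakk>a \<in> carrier M; b \<in> carrier N\<rbrakk> \<Longrightarrow> free_gen a b \<in> carrier (free_algebra M N)"
  by (simp add: free_algebra_carrier indicator_eq_0_iff)

lemma free_algebra_vectorspace: "vectorspace class_ring (free_algebra M N)"
proof (rule vectorspace_realI)
  show "abelian_group (free_algebra M N)"
  proof (rule abelian_groupI)
    fix f assume "f \<in> carrier (free_algebra M N)"
    then show "\<exists>h\<in>carrier (free_algebra M N). h \<oplus>\<^bsub>free_algebra M N\<^esub> f = \<zero>\<^bsub>free_algebra M N\<^esub>"
      using free_algebra_scale[of f M N "- 1"] by (intro bexI[of _ "\<lambda>p. - 1 * f p"]) auto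
  qed (auto simp: free_algebra_zero free_algebra_add algebra_simps)
qed (auto simp: free_algebra_scale algebra_simps)

text \<open>A finitely supported function is built by adding one scaled generator at a time; the
  induction runs over a finite set containing the support, so the support itself need not be tracked
  exactly.\<close>

lemma free_algebra_induct [consumes 1, case_names zero add]:
  assumes f: "f \<in> carrier (free_algebra M N)"
    and zero: "P (\<lambda>_. 0)"
    and step: "\<And>f r a b. \<lbrakk>f \<in> carrier (free_algebra M N); a \<in> carrier M; b \<in> carrier N; P f\<rbrakk>
      \<Longrightarrow> P (\<lambda>p. f p + r * free_gen a b p)"
  shows "P f"
proof -
  have "P f" if "finite S" "{p. f p \<noteq> 0} \<subseteq> S" "S \<subseteq> carrier M \<times> carrier N" for S f
    using that
  proof (induction S arbitrary: f rule: finite_induct)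
    case empty
    then have "f = (\<lambda>_. 0)" by auto
    then show ?case using zero by simp
  next
    case (insert x S)
    let ?h = "f(x := 0)"
    have h: "{p. ?h p \<noteq> 0} \<subseteq> S" using insert.prems(1) by auto
    then have Ph: "P ?h" using insert by auto
    have hc: "?h \<in> carrier (free_algebra M N)"
      unfolding free_algebra_carrier using h insert finite_subset by blast
    have "P (\<lambda>p. ?h p + f x * free_gen (fst x) (snd x) p)"
      using insert.prems(2) by (intro step[OF hc _ _ Ph]) auto
    moreover have "(\<lambda>p. ?h p + f x * free_gen (fst x) (snd x) p) = f"
      by (auto simp: indicator_def)
    ultimately show ?case by simp
  qed
  then show ?thesis using f unfolding free_algebra_carrier by blast
qed

text \<open>Summing over any finite rectangle that contains the supports gives products with
  different supports a common index set, which is what bilinearity needs.\<close>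

lemma free_algebra_mult:
  assumes "finite S" "finite T" "{p. f p \<noteq> 0} \<subseteq> S" "{p. h p \<noteq> 0} \<subseteq> T"
  shows "(\<otimes>\<^bsub>free_algebra M N\<^esub>) f h = (\<lambda>r. \<Sum>(p, q)\<in>S \<times> T.
    if (fst p \<otimes>\<^bsub>M\<^esub> fst q, snd p \<otimes>\<^bsub>N\<^esub> snd q) = r then f p * h q else 0)"
proof
  fix r
  let ?m = "\<lambda>p q. (fst p \<otimes>\<^bsub>M\<^esub> fst q, snd p \<otimes>\<^bsub>N\<^esub> snd q)"
  have "(\<otimes>\<^bsub>free_algebra M N\<^esub>) f h r =
      (\<Sum>(p, q)\<in>{(p, q). f p \<noteq> 0 \<and> h q \<noteq> 0 \<and> ?m p q = r}. f p * h q)"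
    by (simp add: free_algebra_def)
  also have "\<dots> = (\<Sum>(p, q)\<in>S \<times> T. if ?m p q = r then f p * h q else 0)"
    using assms by (intro sum.mono_neutral_cong_left) (auto split: if_splits)
  finally show "(\<otimes>\<^bsub>free_algebra M N\<^esub>) f h r = (\<Sum>(p, q)\<in>S \<times> T. if ?m p q = r then f p * h q else 0)" .
qed

lemma free_algebra_mult_gen:
  "(\<otimes>\<^bsub>free_algebra M N\<^esub>) (free_gen a b) (free_gen a' b') = free_gen (a \<otimes>\<^bsub>M\<^esub> a') (b \<otimes>\<^bsub>N\<^esub> b')"
proof -
  have "(\<otimes>\<^bsub>free_algebra M N\<^esub>) (free_gen a b) (free_gen a' b') = (\<lambda>r. \<Sum>(p, q)\<in>{(a, b)} \<times> {(a', b')}.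
    if (fst p \<otimes>\<^bsub>M\<^esub> fst q, snd p \<otimes>\<^bsub>N\<^esub> snd q) = r then free_gen a b p * free_gen a' b' q else 0)"
    by (rule free_algebra_mult) (auto simp: indicator_eq_0_iff)
  also have "\<dots> = free_gen (a \<otimes>\<^bsub>M\<^esub> a') (b \<otimes>\<^bsub>N\<^esub> b')" by (auto simp: indicator_def)
  finally show ?thesis .
qed

lemma free_algebra_mult_zero:
  "(\<otimes>\<^bsub>free_algebra M N\<^esub>) (\<lambda>_. 0) h = (\<lambda>_. 0)" "(\<otimes>\<^bsub>free_algebra M N\<^esub>) h (\<lambda>_. 0) = (\<lambda>_. 0)"
  by (auto simp: free_algebra_def)

lemma free_algebra_mult_linear:
  assumes "f \<in> carrier (free_algebra M N)" "f' \<in> carrier (free_algebra M N)" "h \<in> carrier (free_algebra M N)"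
  shows "(\<otimes>\<^bsub>free_algebra M N\<^esub>) (\<lambda>p. f p + s * f' p) h =
      (\<lambda>p. (\<otimes>\<^bsub>free_algebra M N\<^esub>) f h p + s * (\<otimes>\<^bsub>free_algebra M N\<^esub>) f' h p)"
    and "(\<otimes>\<^bsub>free_algebra M N\<^esub>) h (\<lambda>p. f p + s * f' p) =
      (\<lambda>p. (\<otimes>\<^bsub>free_algebra M N\<^esub>) h f p + s * (\<otimes>\<^bsub>free_algebra M N\<^esub>) h f' p)"
proof -
  let ?S = "{p. f p \<noteq> 0} \<union> {p. f' p \<noteq> 0}" and ?T = "{p. h p \<noteq> 0}"
  have fin: "finite ?S" "finite ?T" using assms by (auto simp: free_algebra_carrier)
  have sub: "{p. f p + s * f' p \<noteq> 0} \<subseteq> ?S" "{p. f p \<noteq> 0} \<subseteq> ?S" "{p. f' p \<noteq> 0} \<subseteq> ?S" "?T \<subseteq> ?T" by auto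
  note m = free_algebra_mult[OF fin sub(1,4)] free_algebra_mult[OF fin sub(2,4)] free_algebra_mult[OF fin sub(3,4)]
    free_algebra_mult[OF fin(2,1) sub(4,1)] free_algebra_mult[OF fin(2,1) sub(4,2)] free_algebra_mult[OF fin(2,1) sub(4,3)]
  show "(\<otimes>\<^bsub>free_algebra M N\<^esub>) (\<lambda>p. f p + s * f' p) h =
      (\<lambda>p. (\<otimes>\<^bsub>free_algebra M N\<^esub>) f h p + s * (\<otimes>\<^bsub>free_algebra M N\<^esub>) f' h p)"
    "(\<otimes>\<^bsub>free_algebra M N\<^esub>) h (\<lambda>p. f p + s * f' p) =
      (\<lambda>p. (\<otimes>\<^bsub>free_algebra M N\<^esub>) h f p + s * (\<otimes>\<^bsub>free_algebra M N\<^esub>) h f' p)"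
    unfolding m sum_distrib_left sum.distrib[symmetric]
    by (intro ext sum.cong; auto simp: algebra_simps)+
qed

lemma free_algebra_mult_closed:
  assumes M: "\<And>x y. \<lbrakk>x \<in> carrier M; y \<in> carrier M\<rbrakk> \<Longrightarrow> x \<otimes>\<^bsub>M\<^esub> y \<in> carrier M"
    and N: "\<And>x y. \<lbrakk>x \<in> carrier N; y \<in> carrier N\<rbrakk> \<Longrightarrow> x \<otimes>\<^bsub>N\<^esub> y \<in> carrier N"
    and f: "f \<in> carrier (free_algebra M N)" and h: "h \<in> carrier (free_algebra M N)"
  shows "(\<otimes>\<^bsub>free_algebra M N\<^esub>) f h \<in> carrier (free_algebra M N)"
  using f
proof (induction rule: free_algebra_induct)
  case zero
  then show ?case by (simp add: free_algebra_mult_zero free_algebra_zero)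
next
  case (add f r a b)
  have "(\<otimes>\<^bsub>free_algebra M N\<^esub>) (free_gen a b) h \<in> carrier (free_algebra M N)"
    using h
  proof (induction rule: free_algebra_induct)
    case zero
    then show ?case by (simp add: free_algebra_mult_zero free_algebra_zero)
  next
    case (add h' r' a' b')
    then show ?case using \<open>a \<in> carrier M\<close> \<open>b \<in> carrier N\<close> M N
      by (simp add: free_algebra_mult_linear free_algebra_gen free_algebra_add free_algebra_scale free_algebra_mult_gen)
  qed
  then show ?case using add h
    by (simp add: free_algebra_mult_linear free_algebra_gen free_algebra_add free_algebra_scale)
qed

text \<open>Closure of the two factors keeps the relations inside the free space, as the facts about
  spans require.\<close>

lemma tensor_kernel_submodule: 
  assumes "\<And>x y. \<lbrakk>x \<in> carrier M; y \<in> carrier M\<rbrakk> \<Longrightarrow> x \<oplus>\<^bsub>M\<^esub> y \<in> carrier M"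
    "\<And>x y. \<lbrakk>x \<in> carrier N; y \<in> carrier N\<rbrakk> \<Longrightarrow> x \<oplus>\<^bsub>N\<^esub> y \<in> carrier N"
    "\<And>r x. x \<in> carrier M \<Longrightarrow> r \<odot>\<^bsub>M\<^esub> x \<in> carrier M" "\<And>r x. x \<in> carrier N \<Longrightarrow> r \<odot>\<^bsub>N\<^esub> x \<in> carrier N"
  shows "submodule class_ring (tensor_kernel M N) (free_algebra M N)"
    and "bilinear_relations M N \<subseteq> tensor_kernel M N"
    and "bilinear_relations M N \<subseteq> carrier (free_algebra M N)"
proof -
  interpret F: vectorspace "class_ring :: real ring" "free_algebra M N" by (rule free_algebra_vectorspace)
  show sub: "bilinear_relations M N \<subseteq> carrier (free_algebra M N)"
    unfolding bilinear_relations_def using assms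
    by (auto intro!: free_algebra_diff free_algebra_scale free_algebra_gen)
  show "submodule class_ring (tensor_kernel M N) (free_algebra M N)"
    unfolding tensor_kernel_def by (rule F.span_is_submodule[OF sub])
  show "bilinear_relations M N \<subseteq> tensor_kernel M N"
    unfolding tensor_kernel_def by (rule F.in_own_span[OF sub])
qed

text \<open>Transport of structure along a surjection compatible with the operations. It makes the
  tensor product a vector space by way of its identification with \<open>A\<close>, bypassing
  quotient axioms.\<close>

lemma vectorspace_image:
  fixes M :: "(real, 'a) module" and N :: "(real, 'b) module"
  assumes M: "vectorspace class_ring M" and carrier: "carrier N = \<phi> ` carrier M"
    and zero: "\<phi> \<zero>\<^bsub>M\<^esub> = \<zero>\<^bsub>N\<^esub>"
    and add: "\<And>x y. \<lbrakk>x \<in> carrier M; y \<in> carrier M\<rbrakk> \<Longrightarrow> \<phi> (x \<oplus>\<^bsub>M\<^esub> y) = \<phi> x \<oplus>\<^bsub>N\<^esub> \<phi> y"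
    and scale: "\<And>r x. x \<in> carrier M \<Longrightarrow> \<phi> (r \<odot>\<^bsub>M\<^esub> x) = r \<odot>\<^bsub>N\<^esub> \<phi> x"
  shows "vectorspace class_ring N"
proof -
  interpret M: vectorspace "class_ring :: real ring" M by fact
  have closed: "r \<odot>\<^bsub>M\<^esub> x \<in> carrier M" if "x \<in> carrier M" for r x
    using M.smult_closed[of r x] that by simp
  have M1: "(r + s) \<odot>\<^bsub>M\<^esub> x = r \<odot>\<^bsub>M\<^esub> x \<oplus>\<^bsub>M\<^esub> s \<odot>\<^bsub>M\<^esub> x" "(r * s) \<odot>\<^bsub>M\<^esub> x = r \<odot>\<^bsub>M\<^esub> (s \<odot>\<^bsub>M\<^esub> x)"
    "1 \<odot>\<^bsub>M\<^esub> x = x" if "x \<in> carrier M" for r s x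
    using M.smult_l_distr[of r s x] M.smult_assoc1[of r s x] M.smult_one[of x] that by simp_all
  have M2: "r \<odot>\<^bsub>M\<^esub> (x \<oplus>\<^bsub>M\<^esub> y) = r \<odot>\<^bsub>M\<^esub> x \<oplus>\<^bsub>M\<^esub> r \<odot>\<^bsub>M\<^esub> y" if "x \<in> carrier M" "y \<in> carrier M" for r x y
    using M.smult_r_distr[of r x y] that by simp
  show ?thesis
  proof (rule vectorspace_realI)
    show "abelian_group N"
    proof (rule abelian_groupI)
      fix x assume "x \<in> carrier N"
      then obtain a where "a \<in> carrier M" "x = \<phi> a" unfolding carrier by blast
      then show "\<exists>y\<in>carrier N. y \<oplus>\<^bsub>N\<^esub> x = \<zero>\<^bsub>N\<^esub>"
        unfolding carrier by (intro bexI[of _ "\<phi> (\<ominus>\<^bsub>M\<^esub> a)"]) (simp_all add: add[symmetric] zero M.l_neg)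
    qed (auto simp: carrier add[symmetric] zero[symmetric] M.a_ac)
  qed (auto simp: carrier add[symmetric] scale[symmetric] closed M1 M2)
qed

section \<open>The multiplication map and its kernel\<close>

context quaternionic_graded_algebra
begin

abbreviation "neutral_alg \<equiv> neutral_subalgebra G A \<Gamma>"

abbreviation "cent_alg \<equiv> neutral_centralizer G A \<Gamma>"

abbreviation "free \<equiv> free_algebra neutral_alg cent_alg"

abbreviation "rel_kernel \<equiv> tensor_kernel neutral_alg cent_alg"

abbreviation "tensor \<equiv> tensor_algebra neutral_alg cent_alg"

lemma neutral_alg_sel [simp]:
  "carrier neutral_alg = \<Gamma> \<one>\<^bsub>G\<^esub>" "(\<otimes>\<^bsub>neutral_alg\<^esub>) = (\<otimes>\<^bsub>A\<^esub>)" "add neutral_alg = add A"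
  "one neutral_alg = \<one>\<^bsub>A\<^esub>" "zero neutral_alg = \<zero>\<^bsub>A\<^esub>" "(\<odot>\<^bsub>neutral_alg\<^esub>) = (\<odot>\<^bsub>A\<^esub>)"
  by (simp_all add: neutral_subalgebra_def)

lemma cent_alg_sel [simp]:
  "carrier cent_alg = cent" "(\<otimes>\<^bsub>cent_alg\<^esub>) = (\<otimes>\<^bsub>A\<^esub>)" "add cent_alg = add A"
  "one cent_alg = \<one>\<^bsub>A\<^esub>" "zero cent_alg = \<zero>\<^bsub>A\<^esub>" "(\<odot>\<^bsub>cent_alg\<^esub>) = (\<odot>\<^bsub>A\<^esub>)"
  by (simp_all add: neutral_centralizer_eq)

lemma neutral_closed [simp]: "x \<in> \<Gamma> \<one>\<^bsub>G\<^esub> \<Longrightarrow> x \<in> carrier A"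
  using component_closed[of "\<one>\<^bsub>G\<^esub>"] by simp

lemma neutral_cent_commute:
  assumes "u \<in> \<Gamma> \<one>\<^bsub>G\<^esub>" "c \<in> cent"
  shows "u \<otimes>\<^bsub>A\<^esub> c = c \<otimes>\<^bsub>A\<^esub> u"
  using assms unfolding centralizer_carrier[symmetric] neutral_centralizer_carrier by auto

lemma neutral_subspace: "subspace class_ring (\<Gamma> \<one>\<^bsub>G\<^esub>) A"
  by (rule component_subspace) simp

lemmas neutral_subspaceD = subspaceD(2-5)[OF neutral_subspace]

lemma neutral_mult_closed: "\<lbrakk>x \<in> \<Gamma> \<one>\<^bsub>G\<^esub>; y \<in> \<Gamma> \<one>\<^bsub>G\<^esub>\<rbrakk> \<Longrightarrow> x \<otimes>\<^bsub>A\<^esub> y \<in> \<Gamma> \<one>\<^bsub>G\<^esub>"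
  using neutral_mult[of "\<one>\<^bsub>G\<^esub>"] by simp

text \<open>The linear extension of \<open>(a, b)\<close> to \<open>a b\<close>, which becomes the
  canonical map from the tensor product to \<open>A\<close>.\<close>

definition "ev f = finsum A (\<lambda>p. f p \<odot>\<^bsub>A\<^esub> (fst p \<otimes>\<^bsub>A\<^esub> snd p)) {p. f p \<noteq> 0}"

lemma ev_superset:
  assumes "finite S" "{p. f p \<noteq> 0} \<subseteq> S" "S \<subseteq> \<Gamma> \<one>\<^bsub>G\<^esub> \<times> cent"
  shows "ev f = finsum A (\<lambda>p. f p \<odot>\<^bsub>A\<^esub> (fst p \<otimes>\<^bsub>A\<^esub> snd p)) S"
  unfolding ev_def using assms
  by (intro add.finprod_mono_neutral_cong_left) (auto simp: subset_iff)

lemma ev_closed [simp]: "f \<in> carrier free \<Longrightarrow> ev f \<in> carrier A"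
  unfolding ev_def free_algebra_carrier by (intro finsum_closed) (auto simp: subset_iff)

lemma ev_linear:
  assumes f: "f \<in> carrier free" and h: "h \<in> carrier free"
  shows "ev (\<lambda>p. f p + r * h p) = ev f \<oplus>\<^bsub>A\<^esub> r \<odot>\<^bsub>A\<^esub> ev h"
proof -
  let ?S = "{p. f p \<noteq> 0} \<union> {p. h p \<noteq> 0}" and ?\<pi> = "\<lambda>p. fst p \<otimes>\<^bsub>A\<^esub> snd p"
  have S: "finite ?S" "?S \<subseteq> \<Gamma> \<one>\<^bsub>G\<^esub> \<times> cent" using f h by (auto simp: free_algebra_carrier)
  have cl: "?\<pi> p \<in> carrier A" if "p \<in> ?S" for p
    using that S(2) by (intro m_closed) (auto intro: neutral_closed cent_closed)
  have "ev (\<lambda>p. f p + r * h p) = finsum A (\<lambda>p. (f p + r * h p) \<odot>\<^bsub>A\<^esub> ?\<pi> p) ?S"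
    by (rule ev_superset[OF S(1) _ S(2)]) auto
  also have "\<dots> = finsum A (\<lambda>p. f p \<odot>\<^bsub>A\<^esub> ?\<pi> p \<oplus>\<^bsub>A\<^esub> r \<odot>\<^bsub>A\<^esub> (h p \<odot>\<^bsub>A\<^esub> ?\<pi> p)) ?S"
    using cl by (intro finsum_cong') (auto simp: add_scale)
  also have "\<dots> = finsum A (\<lambda>p. f p \<odot>\<^bsub>A\<^esub> ?\<pi> p) ?S \<oplus>\<^bsub>A\<^esub> finsum A (\<lambda>p. r \<odot>\<^bsub>A\<^esub> (h p \<odot>\<^bsub>A\<^esub> ?\<pi> p)) ?S"
    using cl by (intro finsum_addf) auto
  also have "finsum A (\<lambda>p. r \<odot>\<^bsub>A\<^esub> (h p \<odot>\<^bsub>A\<^esub> ?\<pi> p)) ?S = r \<odot>\<^bsub>A\<^esub> finsum A (\<lambda>p. h p \<odot>\<^bsub>A\<^esub> ?\<pi> p) ?S"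
    using S cl by (intro finsum_smult_ldistr[symmetric]) auto
  also have "finsum A (\<lambda>p. h p \<odot>\<^bsub>A\<^esub> ?\<pi> p) ?S = ev h"
    by (rule ev_superset[OF S(1) _ S(2), symmetric]) auto
  also have "finsum A (\<lambda>p. f p \<odot>\<^bsub>A\<^esub> ?\<pi> p) ?S = ev f"
    by (rule ev_superset[OF S(1) _ S(2), symmetric]) auto
  finally show ?thesis .
qed

lemma ev_zero [simp]: "ev (\<lambda>_. 0) = \<zero>\<^bsub>A\<^esub>"
  by (simp add: ev_def)

lemma ev_add: "\<lbrakk>f \<in> carrier free; h \<in> carrier free\<rbrakk> \<Longrightarrow> ev (\<lambda>p. f p + h p) = ev f \<oplus>\<^bsub>A\<^esub> ev h"
  using ev_linear[of f h 1] by simp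

lemma ev_diff: "\<lbrakk>f \<in> carrier free; h \<in> carrier free\<rbrakk> \<Longrightarrow> ev (\<lambda>p. f p - h p) = ev f \<ominus>\<^bsub>A\<^esub> ev h"
  using ev_linear[of f h "- 1"] by (simp add: minus_scale a_minus_def)

lemma ev_scale: "f \<in> carrier free \<Longrightarrow> ev (\<lambda>p. r * f p) = r \<odot>\<^bsub>A\<^esub> ev f"
  using ev_linear[OF free_algebra_zero, of f r] by simp

lemma free_gen_closed: "\<lbrakk>a \<in> \<Gamma> \<one>\<^bsub>G\<^esub>; b \<in> cent\<rbrakk> \<Longrightarrow> free_gen a b \<in> carrier free"
  by (rule free_algebra_gen) simp_all

lemma ev_gen:
  assumes "a \<in> \<Gamma> \<one>\<^bsub>G\<^esub>" "b \<in> cent"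
  shows "ev (free_gen a b) = a \<otimes>\<^bsub>A\<^esub> b"
  using assms by (subst ev_superset[of "{(a, b)}"]) (auto simp: indicator_eq_0_iff)

lemma free_mult_closed: "\<lbrakk>f \<in> carrier free; h \<in> carrier free\<rbrakk> \<Longrightarrow> f \<otimes>\<^bsub>free\<^esub> h \<in> carrier free"
  by (rule free_algebra_mult_closed) (simp_all add: neutral_mult_closed cent_mult)

text \<open>On generators this is \<open>(a a') (b b') = (a b) (a' b')\<close>, true because
  \<open>a'\<close> is neutral and \<open>b\<close> centralizes it. Linearity in each argument does
  the rest, hence the nested inductions.\<close>

lemma ev_mult:
  assumes f: "f \<in> carrier free" and h: "h \<in> carrier free"
  shows "ev (f \<otimes>\<^bsub>free\<^esub> h) = ev f \<otimes>\<^bsub>A\<^esub> ev h"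
  using f
proof (induction rule: free_algebra_induct)
  case zero
  then show ?case using h by (simp add: free_algebra_mult_zero)
next
  case (add f r a b)
  then have ab: "a \<in> \<Gamma> \<one>\<^bsub>G\<^esub>" "b \<in> cent" by auto
  have "ev (free_gen a b \<otimes>\<^bsub>free\<^esub> h) = a \<otimes>\<^bsub>A\<^esub> b \<otimes>\<^bsub>A\<^esub> ev h"
    using h
  proof (induction rule: free_algebra_induct)
    case zero
    then show ?case using ab by (simp add: free_algebra_mult_zero)
  next
    case (add h' r' a' b')
    then have ab': "a' \<in> \<Gamma> \<one>\<^bsub>G\<^esub>" "b' \<in> cent" by auto
    have "a \<otimes>\<^bsub>A\<^esub> a' \<otimes>\<^bsub>A\<^esub> (b \<otimes>\<^bsub>A\<^esub> b') = a \<otimes>\<^bsub>A\<^esub> (a' \<otimes>\<^bsub>A\<^esub> b) \<otimes>\<^bsub>A\<^esub> b'"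
      using ab ab' by (simp add: m_assoc)
    also have "\<dots> = a \<otimes>\<^bsub>A\<^esub> b \<otimes>\<^bsub>A\<^esub> (a' \<otimes>\<^bsub>A\<^esub> b')"
      using ab ab' neutral_cent_commute[OF ab'(1) ab(2)] by (simp add: m_assoc)
    finally have "ev (free_gen a b \<otimes>\<^bsub>free\<^esub> free_gen a' b') = a \<otimes>\<^bsub>A\<^esub> b \<otimes>\<^bsub>A\<^esub> (a' \<otimes>\<^bsub>A\<^esub> b')"
      using ab ab' by (simp add: free_algebra_mult_gen ev_gen neutral_mult_closed cent_mult)
    then show ?case using ab ab' add
      by (simp add: free_algebra_mult_linear free_gen_closed ev_linear free_mult_closed ev_gen
          r_distr smult_mult_right)
  qed
  then show ?case using ab add h
    by (simp add: free_algebra_mult_linear free_gen_closed ev_linear free_mult_closed ev_gen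
        l_distr smult_mult_left)
qed

lemma kernel_submodule: "submodule class_ring rel_kernel free"
  and relations_subset_kernel: "bilinear_relations neutral_alg cent_alg \<subseteq> rel_kernel"
  and relations_subset_free: "bilinear_relations neutral_alg cent_alg \<subseteq> carrier free"
  using tensor_kernel_submodule[of neutral_alg cent_alg] by (auto simp: neutral_subspaceD centI)

lemma kernel_zero: "(\<lambda>_. 0) \<in> rel_kernel"
  and kernel_add: "\<lbrakk>f \<in> rel_kernel; h \<in> rel_kernel\<rbrakk> \<Longrightarrow> (\<lambda>p. f p + h p) \<in> rel_kernel"
  and kernel_scale: "f \<in> rel_kernel \<Longrightarrow> (\<lambda>p. r * f p) \<in> rel_kernel"
  using kernel_submodule unfolding submodule_def by auto

text \<open>Congruence modulo the relations. Without a carrier condition on either side, chains of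
  congruences carry no closure obligations.\<close>

definition "eqv f h \<longleftrightarrow> (\<lambda>p. f p - h p) \<in> rel_kernel"

lemma eqv_refl: "eqv f f"
  by (simp add: eqv_def kernel_zero)

lemma eqv_sym: "eqv f h \<Longrightarrow> eqv h f"
  using kernel_scale[of "\<lambda>p. f p - h p" "- 1"] by (simp add: eqv_def)

lemma eqv_trans [trans]: "\<lbrakk>eqv f h; eqv h h'\<rbrakk> \<Longrightarrow> eqv f h'"
  using kernel_add[of "\<lambda>p. f p - h p" "\<lambda>p. h p - h' p"] by (simp add: eqv_def)

lemma eqv_add: "\<lbrakk>eqv f f'; eqv h h'\<rbrakk> \<Longrightarrow> eqv (\<lambda>p. f p + h p) (\<lambda>p. f' p + h' p)"
  using kernel_add[of "\<lambda>p. f p - f' p" "\<lambda>p. h p - h' p"] by (simp add: eqv_def algebra_simps)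

lemma eqv_scale: "eqv f f' \<Longrightarrow> eqv (\<lambda>p. r * f p) (\<lambda>p. r * f' p)"
  using kernel_scale[of "\<lambda>p. f p - f' p" r] by (simp add: eqv_def algebra_simps)

lemma eqv_add_left:
  assumes "a \<in> \<Gamma> \<one>\<^bsub>G\<^esub>" "a' \<in> \<Gamma> \<one>\<^bsub>G\<^esub>" "b \<in> cent"
  shows "eqv (free_gen (a \<oplus>\<^bsub>A\<^esub> a') b) (\<lambda>p. free_gen a b p + free_gen a' b p)"
proof -
  have "(\<lambda>p. free_gen (a \<oplus>\<^bsub>A\<^esub> a') b p - free_gen a b p - free_gen a' b p) \<in> rel_kernel"
    by (rule subsetD[OF relations_subset_kernel]) (use assms in \<open>auto simp: bilinear_relations_def\<close>)
  then show ?thesis by (simp add: eqv_def diff_diff_eq)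
qed

lemma eqv_add_right:
  assumes "a \<in> \<Gamma> \<one>\<^bsub>G\<^esub>" "b \<in> cent" "b' \<in> cent"
  shows "eqv (free_gen a (b \<oplus>\<^bsub>A\<^esub> b')) (\<lambda>p. free_gen a b p + free_gen a b' p)"
proof -
  have "(\<lambda>p. free_gen a (b \<oplus>\<^bsub>A\<^esub> b') p - free_gen a b p - free_gen a b' p) \<in> rel_kernel"
    by (rule subsetD[OF relations_subset_kernel]) (use assms in \<open>auto simp: bilinear_relations_def\<close>)
  then show ?thesis by (simp add: eqv_def diff_diff_eq)
qed

lemma eqv_scale_left:
  assumes "a \<in> \<Gamma> \<one>\<^bsub>G\<^esub>" "b \<in> cent"
  shows "eqv (free_gen (r \<odot>\<^bsub>A\<^esub> a) b) (\<lambda>p. r * free_gen a b p)"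
  unfolding eqv_def
  by (rule subsetD[OF relations_subset_kernel]) (use assms in \<open>auto simp: bilinear_relations_def\<close>)

lemma eqv_scale_right:
  assumes "a \<in> \<Gamma> \<one>\<^bsub>G\<^esub>" "b \<in> cent"
  shows "eqv (free_gen a (r \<odot>\<^bsub>A\<^esub> b)) (\<lambda>p. r * free_gen a b p)"
  unfolding eqv_def
  by (rule subsetD[OF relations_subset_kernel]) (use assms in \<open>auto simp: bilinear_relations_def\<close>)

text \<open>The formal counterpart of \<open>quad\<close>. The units move to the left because the
  first tensor factor is the neutral one; \<open>ev\<close> restores \<open>quad\<close>, since the
  coefficients commute with the units.\<close>

definition "quad_tensor a b c d =
  (\<lambda>p. free_gen \<one>\<^bsub>A\<^esub> a p + free_gen i b p + free_gen j c p + free_gen k d p)"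

text \<open>A linear section of \<open>ev\<close> modulo the bilinearity relations; that every \<open>f\<close> is congruent to
  \<open>sec (ev f)\<close> identifies the span of the relations with the kernel of \<open>ev\<close>.\<close>

definition "sec x = quad_tensor (avg x) (avg (\<ominus>\<^bsub>A\<^esub> (x \<otimes>\<^bsub>A\<^esub> i))) (avg (\<ominus>\<^bsub>A\<^esub> (x \<otimes>\<^bsub>A\<^esub> j)))
  (avg (\<ominus>\<^bsub>A\<^esub> (x \<otimes>\<^bsub>A\<^esub> k)))"

lemma sec_quad:
  "\<lbrakk>a \<in> cent; b \<in> cent; c \<in> cent; d \<in> cent\<rbrakk> \<Longrightarrow> sec (quad a b c d) = quad_tensor a b c d"
  by (simp add: sec_def quad_coords)

lemma quad_tensor_closed:
  "\<lbrakk>a \<in> cent; b \<in> cent; c \<in> cent; d \<in> cent\<rbrakk> \<Longrightarrow> quad_tensor a b c d \<in> carrier free"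
  unfolding quad_tensor_def
  by (intro free_algebra_add free_gen_closed one_neutral i_neutral j_neutral k_neutral)

lemma ev_quad_tensor:
  "\<lbrakk>a \<in> cent; b \<in> cent; c \<in> cent; d \<in> cent\<rbrakk> \<Longrightarrow> ev (quad_tensor a b c d) = quad a b c d"
  unfolding quad_tensor_def quad_def
  by (simp add: ev_add free_algebra_add free_gen_closed ev_gen one_neutral i_neutral j_neutral k_neutral
      cent_commute)

lemma sec_closed: "x \<in> carrier A \<Longrightarrow> sec x \<in> carrier free"
  by (rule quad_cases) (auto simp: sec_quad quad_tensor_closed)

lemma ev_sec: "x \<in> carrier A \<Longrightarrow> ev (sec x) = x"
  by (rule quad_cases) (auto simp: sec_quad ev_quad_tensor)

text \<open>Equality fails in the free space, where the generator of a sum is not the sum of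
  generators; the relations in the second argument repair this.\<close>

lemma sec_linear:
  assumes x: "x \<in> carrier A" and y: "y \<in> carrier A"
  shows "eqv (sec (x \<oplus>\<^bsub>A\<^esub> r \<odot>\<^bsub>A\<^esub> y)) (\<lambda>p. sec x p + r * sec y p)"
proof -
  obtain a b c d where abcd: "a \<in> cent" "b \<in> cent" "c \<in> cent" "d \<in> cent" and x': "x = quad a b c d"
    by (rule quad_cases[OF x])
  obtain a' b' c' d' where abcd': "a' \<in> cent" "b' \<in> cent" "c' \<in> cent" "d' \<in> cent"
    and y': "y = quad a' b' c' d'" by (rule quad_cases[OF y])
  have *: "eqv (free_gen u (v \<oplus>\<^bsub>A\<^esub> r \<odot>\<^bsub>A\<^esub> w)) (\<lambda>p. free_gen u v p + r * free_gen u w p)"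
    if "u \<in> \<Gamma> \<one>\<^bsub>G\<^esub>" "v \<in> cent" "w \<in> cent" for u v w
    using eqv_add_right[of u v "r \<odot>\<^bsub>A\<^esub> w"] eqv_add[OF eqv_refl eqv_scale_right[of u w r]] that
    by (blast intro: eqv_trans centI)
  have "x \<oplus>\<^bsub>A\<^esub> r \<odot>\<^bsub>A\<^esub> y = quad (a \<oplus>\<^bsub>A\<^esub> r \<odot>\<^bsub>A\<^esub> a') (b \<oplus>\<^bsub>A\<^esub> r \<odot>\<^bsub>A\<^esub> b') (c \<oplus>\<^bsub>A\<^esub> r \<odot>\<^bsub>A\<^esub> c') (d \<oplus>\<^bsub>A\<^esub> r \<odot>\<^bsub>A\<^esub> d')"
    unfolding x' y' using abcd abcd' by (simp add: quad_scale quad_add)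
  then have "sec (x \<oplus>\<^bsub>A\<^esub> r \<odot>\<^bsub>A\<^esub> y) =
      quad_tensor (a \<oplus>\<^bsub>A\<^esub> r \<odot>\<^bsub>A\<^esub> a') (b \<oplus>\<^bsub>A\<^esub> r \<odot>\<^bsub>A\<^esub> b') (c \<oplus>\<^bsub>A\<^esub> r \<odot>\<^bsub>A\<^esub> c') (d \<oplus>\<^bsub>A\<^esub> r \<odot>\<^bsub>A\<^esub> d')"
    using abcd abcd' by (simp add: sec_quad centI)
  moreover have "eqv (quad_tensor (a \<oplus>\<^bsub>A\<^esub> r \<odot>\<^bsub>A\<^esub> a') (b \<oplus>\<^bsub>A\<^esub> r \<odot>\<^bsub>A\<^esub> b') (c \<oplus>\<^bsub>A\<^esub> r \<odot>\<^bsub>A\<^esub> c') (d \<oplus>\<^bsub>A\<^esub> r \<odot>\<^bsub>A\<^esub> d'))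
      (\<lambda>p. (free_gen \<one>\<^bsub>A\<^esub> a p + r * free_gen \<one>\<^bsub>A\<^esub> a' p) + (free_gen i b p + r * free_gen i b' p)
        + (free_gen j c p + r * free_gen j c' p) + (free_gen k d p + r * free_gen k d' p))"
    unfolding quad_tensor_def using abcd abcd'
    by (intro eqv_add * one_neutral i_neutral j_neutral k_neutral)
  moreover have "(\<lambda>p. (free_gen \<one>\<^bsub>A\<^esub> a p + r * free_gen \<one>\<^bsub>A\<^esub> a' p) + (free_gen i b p + r * free_gen i b' p)
        + (free_gen j c p + r * free_gen j c' p) + (free_gen k d p + r * free_gen k d' p))
      = (\<lambda>p. sec x p + r * sec y p)"
    using abcd abcd' unfolding x' y' by (simp add: sec_quad quad_tensor_def algebra_simps)
  ultimately show ?thesis by simp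
qed

text \<open>\<open>sec\<close> of zero is a sum of four generators with second entry zero, not the
  zero function; each is killed by the scaling relation with factor 0.\<close>

lemma sec_zero: "eqv (sec \<zero>\<^bsub>A\<^esub>) (\<lambda>_. 0)"
proof -
  have *: "eqv (free_gen u \<zero>\<^bsub>A\<^esub>) (\<lambda>_. 0)" if "u \<in> \<Gamma> \<one>\<^bsub>G\<^esub>" for u
    using eqv_scale_right[OF that centI(1), of 0] by simp
  have "\<zero>\<^bsub>A\<^esub> = quad \<zero>\<^bsub>A\<^esub> \<zero>\<^bsub>A\<^esub> \<zero>\<^bsub>A\<^esub> \<zero>\<^bsub>A\<^esub>" by (simp add: quad_def)
  then have "sec \<zero>\<^bsub>A\<^esub> = quad_tensor \<zero>\<^bsub>A\<^esub> \<zero>\<^bsub>A\<^esub> \<zero>\<^bsub>A\<^esub> \<zero>\<^bsub>A\<^esub>"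
    using sec_quad[OF centI(1) centI(1) centI(1) centI(1)] by simp
  moreover have "eqv (quad_tensor \<zero>\<^bsub>A\<^esub> \<zero>\<^bsub>A\<^esub> \<zero>\<^bsub>A\<^esub> \<zero>\<^bsub>A\<^esub>) (\<lambda>_. 0 + 0 + 0 + 0)"
    unfolding quad_tensor_def
    by (intro eqv_add * one_neutral i_neutral j_neutral k_neutral)
  ultimately show ?thesis by simp
qed

text \<open>Here real coordinates matter: \<open>a\<close> is a real combination of 1,
  \<open>i\<close>, \<open>j\<close>, \<open>k\<close>, and real scalars may be moved across the
  tensor sign from \<open>a\<close> to \<open>b\<close>.\<close>

lemma gen_eqv_sec:
  assumes a: "a \<in> \<Gamma> \<one>\<^bsub>G\<^esub>" and b: "b \<in> cent"
  shows "eqv (free_gen a b) (sec (a \<otimes>\<^bsub>A\<^esub> b))"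
proof -
  note units = one_neutral i_neutral j_neutral k_neutral
  obtain a1 a2 a3 a4 where "a1 \<in> cent \<inter> \<Gamma> \<one>\<^bsub>G\<^esub>" "a2 \<in> cent \<inter> \<Gamma> \<one>\<^bsub>G\<^esub>" "a3 \<in> cent \<inter> \<Gamma> \<one>\<^bsub>G\<^esub>"
    "a4 \<in> cent \<inter> \<Gamma> \<one>\<^bsub>G\<^esub>" and a_eq: "a = quad a1 a2 a3 a4"
    by (rule component_quad_cases[OF _ a]) simp
  then obtain p q r s where *: "a1 = p \<odot>\<^bsub>A\<^esub> \<one>\<^bsub>A\<^esub>" "a2 = q \<odot>\<^bsub>A\<^esub> \<one>\<^bsub>A\<^esub>" "a3 = r \<odot>\<^bsub>A\<^esub> \<one>\<^bsub>A\<^esub>" "a4 = s \<odot>\<^bsub>A\<^esub> \<one>\<^bsub>A\<^esub>"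
    by (meson IntD1 IntD2 neutral_cent)
  then have a': "a = p \<odot>\<^bsub>A\<^esub> \<one>\<^bsub>A\<^esub> \<oplus>\<^bsub>A\<^esub> q \<odot>\<^bsub>A\<^esub> i \<oplus>\<^bsub>A\<^esub> r \<odot>\<^bsub>A\<^esub> j \<oplus>\<^bsub>A\<^esub> s \<odot>\<^bsub>A\<^esub> k"
    unfolding a_eq quad_def by (simp add: smult_mult_left)
  have switch: "eqv (free_gen (t \<odot>\<^bsub>A\<^esub> u) b) (free_gen u (t \<odot>\<^bsub>A\<^esub> b))" if "u \<in> \<Gamma> \<one>\<^bsub>G\<^esub>" for t u
    using eqv_scale_left[OF that b, of t] eqv_scale_right[OF that b, of t] by (blast intro: eqv_trans eqv_sym)
  have step: "eqv (free_gen (x \<oplus>\<^bsub>A\<^esub> t \<odot>\<^bsub>A\<^esub> u) b) (\<lambda>p. f p + free_gen u (t \<odot>\<^bsub>A\<^esub> b) p)"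
    if "eqv (free_gen x b) f" "x \<in> \<Gamma> \<one>\<^bsub>G\<^esub>" "u \<in> \<Gamma> \<one>\<^bsub>G\<^esub>" for x t u f
    using eqv_trans[OF eqv_add_left[of x "t \<odot>\<^bsub>A\<^esub> u" b] eqv_add[OF that(1) switch[OF that(3), of t]]] that b
    by (simp add: neutral_subspaceD)
  have "eqv (free_gen a b) (quad_tensor (p \<odot>\<^bsub>A\<^esub> b) (q \<odot>\<^bsub>A\<^esub> b) (r \<odot>\<^bsub>A\<^esub> b) (s \<odot>\<^bsub>A\<^esub> b))"
    unfolding a' quad_tensor_def using units by (intro step switch neutral_subspaceD)
  moreover have "a \<otimes>\<^bsub>A\<^esub> b = quad (p \<odot>\<^bsub>A\<^esub> b) (q \<odot>\<^bsub>A\<^esub> b) (r \<odot>\<^bsub>A\<^esub> b) (s \<odot>\<^bsub>A\<^esub> b)"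
    unfolding a' quad_def using b by (simp add: l_distr smult_mult_left cent_commute)
  ultimately show ?thesis using b by (simp add: sec_quad centI)
qed

lemma eqv_sec_ev:
  assumes "f \<in> carrier free"
  shows "eqv f (sec (ev f))"
  using assms
proof (induction rule: free_algebra_induct)
  case zero
  show ?case using eqv_sym[OF sec_zero] by simp
next
  case (add f r a b)
  then have ab: "a \<in> \<Gamma> \<one>\<^bsub>G\<^esub>" "b \<in> cent" by auto
  have "eqv (\<lambda>p. f p + r * free_gen a b p) (\<lambda>p. sec (ev f) p + r * sec (a \<otimes>\<^bsub>A\<^esub> b) p)"
    by (intro eqv_add eqv_scale add.IH gen_eqv_sec ab)
  also have "eqv \<dots> (sec (ev f \<oplus>\<^bsub>A\<^esub> r \<odot>\<^bsub>A\<^esub> (a \<otimes>\<^bsub>A\<^esub> b)))"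
    using add ab by (intro eqv_sym[OF sec_linear]) auto
  also have "ev f \<oplus>\<^bsub>A\<^esub> r \<odot>\<^bsub>A\<^esub> (a \<otimes>\<^bsub>A\<^esub> b) = ev (\<lambda>p. f p + r * free_gen a b p)"
    using add ab by (simp add: ev_linear free_gen_closed ev_gen)
  finally show ?case .
qed

text \<open>The relations evaluate to zero. Conversely, if \<open>ev f\<close> is zero, then
  \<open>f\<close> is congruent to \<open>sec\<close> of zero and so to the zero function.\<close>

lemma kernel_eq: "rel_kernel = {f \<in> carrier free. ev f = \<zero>\<^bsub>A\<^esub>}"
proof
  interpret F: vectorspace "class_ring :: real ring" free by (rule free_algebra_vectorspace)
  have "submodule class_ring {f \<in> carrier free. ev f = \<zero>\<^bsub>A\<^esub>} free"
    unfolding submodule_def using F.module_axioms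
    by (auto simp: free_algebra_add free_algebra_scale free_algebra_zero ev_add ev_scale)
  moreover have "f \<in> carrier free \<and> ev f = \<zero>\<^bsub>A\<^esub>" if f: "f \<in> bilinear_relations neutral_alg cent_alg" for f
  proof
    show "f \<in> carrier free" using f relations_subset_free by blast
    have cancel: "x \<oplus>\<^bsub>A\<^esub> (y \<oplus>\<^bsub>A\<^esub> (\<ominus>\<^bsub>A\<^esub> x \<oplus>\<^bsub>A\<^esub> \<ominus>\<^bsub>A\<^esub> y)) = \<zero>\<^bsub>A\<^esub>"
      if "x \<in> carrier A" "y \<in> carrier A" for x y using that by algebra
    show "ev f = \<zero>\<^bsub>A\<^esub>"
      using f unfolding bilinear_relations_def
      by (auto simp: ev_diff ev_scale free_algebra_diff free_algebra_scale free_gen_closed ev_gen neutral_subspaceD centI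
          l_distr r_distr smult_mult_left smult_mult_right a_minus_def minus_add a_ac r_neg cancel)
  qed
  ultimately show "rel_kernel \<subseteq> {f \<in> carrier free. ev f = \<zero>\<^bsub>A\<^esub>}"
    unfolding tensor_kernel_def by (intro F.span_is_subset) auto
  show "{f \<in> carrier free. ev f = \<zero>\<^bsub>A\<^esub>} \<subseteq> rel_kernel"
  proof
    fix f assume "f \<in> {f \<in> carrier free. ev f = \<zero>\<^bsub>A\<^esub>}"
    then have "eqv f (\<lambda>_. 0)" using eqv_sec_ev[of f] eqv_trans[OF _ sec_zero] by auto
    then show "f \<in> rel_kernel" by (simp add: eqv_def)
  qed
qed

section \<open>The tensor product as the set of fibres of multiplication\<close>

definition "fibre x = {f \<in> carrier free. ev f = x}"

text \<open>By \<open>kernel_eq\<close> two elements of the free space are congruent exactly when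
  \<open>ev\<close> agrees on them. Elements of the tensor product thus are fibres, and
  \<open>fibre\<close> inverts the multiplication map.\<close>

lemma kernel_coset:
  assumes f: "f \<in> carrier free"
  shows "rel_kernel +>\<^bsub>free\<^esub> f = fibre (ev f)"
proof (intro equalityI subsetI)
  fix h assume "h \<in> rel_kernel +>\<^bsub>free\<^esub> f"
  then obtain h' where "h' \<in> rel_kernel" "h = (\<lambda>p. h' p + f p)" by (auto simp: a_r_coset_def')
  then show "h \<in> fibre (ev f)" using f by (simp add: kernel_eq fibre_def free_algebra_add ev_add)
next
  fix h assume "h \<in> fibre (ev f)"
  then have h: "h \<in> carrier free" "ev h = ev f" by (auto simp: fibre_def)
  have "(\<lambda>p. h p - f p) \<in> carrier free" using h(1) f by (rule free_algebra_diff)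
  moreover have "ev (\<lambda>p. h p - f p) = \<zero>\<^bsub>A\<^esub>" using f h by (simp add: ev_diff a_minus_def r_neg)
  ultimately have "(\<lambda>p. h p - f p) \<in> rel_kernel" by (simp add: kernel_eq)
  then show "h \<in> rel_kernel +>\<^bsub>free\<^esub> f"
    unfolding a_r_coset_def' by (intro UN_I[of "\<lambda>p. h p - f p"]) auto
qed

lemma fibre_sec: "x \<in> carrier A \<Longrightarrow> sec x \<in> fibre x"
  by (simp add: fibre_def sec_closed ev_sec)

lemma tensor_carrier: "carrier tensor = fibre ` carrier A"
proof -
  have "carrier tensor = (\<Union>f\<in>carrier free. {rel_kernel +>\<^bsub>free\<^esub> f})"
    by (simp add: tensor_algebra_def FactRing_def Let_def A_RCOSETS_def')
  also have "\<dots> = fibre ` ev ` carrier free" by (auto simp: kernel_coset)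
  also have "ev ` carrier free = carrier A"
  proof (intro equalityI subsetI)
    fix x assume "x \<in> carrier A"
    then show "x \<in> ev ` carrier free" using ev_sec[of x] sec_closed[of x] by force
  qed auto
  finally show ?thesis .
qed

lemma tensor_zero: "fibre \<zero>\<^bsub>A\<^esub> = \<zero>\<^bsub>tensor\<^esub>"
  by (simp add: tensor_algebra_def FactRing_def Let_def kernel_eq fibre_def)

lemma tensor_one: "fibre \<one>\<^bsub>A\<^esub> = \<one>\<^bsub>tensor\<^esub>"
  using kernel_coset[OF free_gen_closed[OF one_neutral cent_one]] ev_gen[OF one_neutral cent_one]
  by (simp add: tensor_algebra_def FactRing_def Let_def)

lemma tensor_mult:
  assumes x: "x \<in> carrier A" and y: "y \<in> carrier A"
  shows "fibre (x \<otimes>\<^bsub>A\<^esub> y) = fibre x \<otimes>\<^bsub>tensor\<^esub> fibre y"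
proof -
  have "fibre x \<otimes>\<^bsub>tensor\<^esub> fibre y = (\<Union>f\<in>fibre x. \<Union>h\<in>fibre y. rel_kernel +>\<^bsub>free\<^esub> (f \<otimes>\<^bsub>free\<^esub> h))"
    by (simp add: tensor_algebra_def FactRing_def Let_def rcoset_mult_def)
  also have "\<dots> = (\<Union>f\<in>fibre x. \<Union>h\<in>fibre y. fibre (x \<otimes>\<^bsub>A\<^esub> y))"
    by (intro SUP_cong refl) (auto simp: fibre_def[of x] fibre_def[of y] kernel_coset free_mult_closed ev_mult)
  \<comment> \<open>A union of equal sets collapses only over a nonempty index set;
    \<open>sec\<close> supplies a point of each fibre.\<close>
  also have "\<dots> = fibre (x \<otimes>\<^bsub>A\<^esub> y)" using fibre_sec[OF x] fibre_sec[OF y] by auto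
  finally show ?thesis by simp
qed

lemma tensor_add:
  assumes x: "x \<in> carrier A" and y: "y \<in> carrier A"
  shows "fibre (x \<oplus>\<^bsub>A\<^esub> y) = fibre x \<oplus>\<^bsub>tensor\<^esub> fibre y"
proof -
  have *: "fibre x \<oplus>\<^bsub>tensor\<^esub> fibre y = (\<Union>f\<in>fibre x. \<Union>h\<in>fibre y. {\<lambda>p. f p + h p})"
    by (simp add: tensor_algebra_def FactRing_def Let_def set_add_def')
  show ?thesis unfolding *
  proof (intro equalityI subsetI)
    fix f assume f: "f \<in> fibre (x \<oplus>\<^bsub>A\<^esub> y)"
    \<comment> \<open>The addition of the quotient is the elementwise sum of sets, so an arbitrary
      point over \<open>x + y\<close> must be split: \<open>sec x\<close> lies over
      \<open>x\<close>, and the remainder lies over \<open>y\<close>.\<close>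
    let ?h = "\<lambda>p. f p - sec x p"
    have "?h \<in> carrier free"
      using f by (intro free_algebra_diff sec_closed x) (simp add: fibre_def)
    moreover have "x \<oplus>\<^bsub>A\<^esub> y \<ominus>\<^bsub>A\<^esub> x = y" using x y by algebra
    then have "ev ?h = y" using f x by (simp add: fibre_def ev_diff sec_closed ev_sec)
    ultimately have "?h \<in> fibre y" by (simp add: fibre_def)
    moreover have "f = (\<lambda>p. sec x p + ?h p)" by simp
    ultimately show "f \<in> (\<Union>f\<in>fibre x. \<Union>h\<in>fibre y. {\<lambda>p. f p + h p})"
      using fibre_sec[OF x] by blast
  qed (auto simp: fibre_def free_algebra_add ev_add)
qed

lemma tensor_scale:
  assumes x: "x \<in> carrier A"
  shows "fibre (r \<odot>\<^bsub>A\<^esub> x) = r \<odot>\<^bsub>tensor\<^esub> fibre x"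
proof -
  have "r \<odot>\<^bsub>tensor\<^esub> fibre x = (\<Union>f\<in>fibre x. rel_kernel +>\<^bsub>free\<^esub> (\<lambda>p. r * f p))"
    by (simp add: tensor_algebra_def Let_def)
  also have "\<dots> = (\<Union>f\<in>fibre x. fibre (r \<odot>\<^bsub>A\<^esub> x))"
    by (intro SUP_cong refl) (auto simp: fibre_def[of x] kernel_coset free_algebra_scale ev_scale)
  also have "\<dots> = fibre (r \<odot>\<^bsub>A\<^esub> x)" using fibre_sec[OF x] by auto
  finally show ?thesis by simp
qed

lemma fibre_inj: "inj_on fibre (carrier A)"
proof (rule inj_onI)
  fix x y assume "x \<in> carrier A" "y \<in> carrier A" "fibre x = fibre y"
  then have "sec x \<in> fibre x \<inter> fibre y" using fibre_sec[of x] by auto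
  then show "x = y" by (auto simp: fibre_def)
qed

lemma fibre_algebra_iso: "fibre \<in> algebra_iso A tensor"
  using fibre_inj
  by (intro algebra_isoI) (simp_all add: bij_betw_def tensor_carrier tensor_one tensor_mult tensor_add tensor_scale)

lemma pure_tensor_eq:
  "\<lbrakk>a \<in> \<Gamma> \<one>\<^bsub>G\<^esub>; b \<in> cent\<rbrakk> \<Longrightarrow> pure_tensor neutral_alg cent_alg a b = fibre (a \<otimes>\<^bsub>A\<^esub> b)"
  unfolding pure_tensor_def by (simp add: kernel_coset free_gen_closed ev_gen)

text \<open>Products of neutral elements with elements of degree \<open>g\<close> have degree
  \<open>g\<close>, which bounds the span from above. Conversely the coordinates of an element of
  degree \<open>g\<close> exhibit its fibre as a sum of four pure tensors with left entries 1,
  \<open>i\<close>, \<open>j\<close>, \<open>k\<close>.\<close>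

lemma fibre_component:
  assumes g: "g \<in> carrier G"
  shows "fibre ` \<Gamma> g = tensor_grading neutral_alg cent_alg (centralizer_grading G A \<Gamma>) g"
proof -
  interpret T: vectorspace "class_ring :: real ring" tensor
    by (rule vectorspace_image[OF vectorspace_axioms tensor_carrier tensor_zero tensor_add tensor_scale])
  note \<Gamma>g = subspaceD[OF component_subspace[OF g]]
  let ?P = "{pure_tensor neutral_alg cent_alg a b |a b.
    a \<in> carrier neutral_alg \<and> b \<in> centralizer_grading G A \<Gamma> g}"
  have P: "?P = {fibre (a \<otimes>\<^bsub>A\<^esub> b) |a b. a \<in> \<Gamma> \<one>\<^bsub>G\<^esub> \<and> b \<in> cent \<inter> \<Gamma> g}"
    by (force simp: centralizer_grading_eq pure_tensor_eq)
  have sub: "?P \<subseteq> carrier tensor" unfolding P tensor_carrier by auto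
  note span = T.span_is_submodule[OF sub, unfolded submodule_def] and own = T.in_own_span[OF sub]
  have sm: "submodule class_ring (fibre ` \<Gamma> g) tensor"
    unfolding submodule_def
  proof (intro conjI allI impI)
    show "fibre ` \<Gamma> g \<subseteq> carrier tensor" unfolding tensor_carrier using \<Gamma>g(1) by blast
    show "\<zero>\<^bsub>tensor\<^esub> \<in> fibre ` \<Gamma> g" using \<Gamma>g(2) by (auto simp: tensor_zero[symmetric])
    show "v \<oplus>\<^bsub>tensor\<^esub> w \<in> fibre ` \<Gamma> g" if "v \<in> fibre ` \<Gamma> g" "w \<in> fibre ` \<Gamma> g" for v w
    proof -
      obtain x y where "v = fibre x" "w = fibre y" "x \<in> \<Gamma> g" "y \<in> \<Gamma> g" using \<open>v \<in> _\<close> \<open>w \<in> _\<close> by blast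
      then show ?thesis using \<Gamma>g(1) \<Gamma>g(3)[of x y] tensor_add[of x y] by (auto simp: subset_iff)
    qed
    show "c \<odot>\<^bsub>tensor\<^esub> v \<in> fibre ` \<Gamma> g" if "v \<in> fibre ` \<Gamma> g" for c v
    proof -
      obtain x where "v = fibre x" "x \<in> \<Gamma> g" using \<open>v \<in> _\<close> by blast
      then show ?thesis using \<Gamma>g(1) \<Gamma>g(4)[of x c] tensor_scale[of x c] by (auto simp: subset_iff)
    qed
  qed (rule T.module_axioms)
  show ?thesis
    unfolding tensor_grading_def
  proof
    have "a \<otimes>\<^bsub>A\<^esub> b \<in> \<Gamma> g" if "a \<in> \<Gamma> \<one>\<^bsub>G\<^esub>" "b \<in> cent \<inter> \<Gamma> g" for a b
      using neutral_mult(2)[OF g] that by blast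
    then have "?P \<subseteq> fibre ` \<Gamma> g" unfolding P by blast
    then show "T.span ?P \<subseteq> fibre ` \<Gamma> g" by (rule T.span_is_subset[OF _ sm])
    show "fibre ` \<Gamma> g \<subseteq> T.span ?P"
    proof
      fix y assume "y \<in> fibre ` \<Gamma> g"
      then obtain x where x: "x \<in> \<Gamma> g" and y: "y = fibre x" by blast
      obtain a b c d where abcd: "a \<in> cent \<inter> \<Gamma> g" "b \<in> cent \<inter> \<Gamma> g" "c \<in> cent \<inter> \<Gamma> g" "d \<in> cent \<inter> \<Gamma> g"
        and x': "x = quad a b c d" by (rule component_quad_cases[OF g x])
      have x'': "x = \<one>\<^bsub>A\<^esub> \<otimes>\<^bsub>A\<^esub> a \<oplus>\<^bsub>A\<^esub> i \<otimes>\<^bsub>A\<^esub> b \<oplus>\<^bsub>A\<^esub> j \<otimes>\<^bsub>A\<^esub> c \<oplus>\<^bsub>A\<^esub> k \<otimes>\<^bsub>A\<^esub> d"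
        unfolding x' quad_def using abcd by (simp add: cent_commute)
      have mem: "fibre (u \<otimes>\<^bsub>A\<^esub> v) \<in> T.span ?P" if "u \<in> \<Gamma> \<one>\<^bsub>G\<^esub>" "v \<in> cent \<inter> \<Gamma> g" for u v
        using own that unfolding P by blast
      have y': "y = fibre (\<one>\<^bsub>A\<^esub> \<otimes>\<^bsub>A\<^esub> a) \<oplus>\<^bsub>tensor\<^esub> fibre (i \<otimes>\<^bsub>A\<^esub> b) \<oplus>\<^bsub>tensor\<^esub> fibre (j \<otimes>\<^bsub>A\<^esub> c) \<oplus>\<^bsub>tensor\<^esub> fibre (k \<otimes>\<^bsub>A\<^esub> d)"
        unfolding y x'' using abcd by (simp add: tensor_add)
      have add: "v \<oplus>\<^bsub>tensor\<^esub> w \<in> T.span ?P" if "v \<in> T.span ?P" "w \<in> T.span ?P" for v w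
        using span that by blast
      show "y \<in> T.span ?P"
        unfolding y' by (intro add mem one_neutral i_neutral j_neutral k_neutral abcd)
    qed
  qed
qed

lemma graded_isomorphic_tensor:
  "graded_isomorphic G A \<Gamma> tensor (tensor_grading neutral_alg cent_alg (centralizer_grading G A \<Gamma>))"
  unfolding graded_isomorphic_def using fibre_algebra_iso fibre_component by blast

end

theorem theorem2p7:
  fixes G :: "('g, 'm) monoid_scheme" and D :: "(real, 'a) module" and \<Gamma> :: "'g \<Rightarrow> 'a set"
    and D1 :: "(real, 'b) module" and \<Gamma>1 :: "'g \<Rightarrow> 'b set"
    and H :: "('h, 'n) monoid_scheme" and D2 :: "(real, 'c) module" and \<Gamma>2 :: "'h \<Rightarrow> 'c set"
  assumes D: "graded_division_algebra G D \<Gamma>"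
    and dim4: "\<forall>g \<in> grading_support G D \<Gamma>. has_dim D (\<Gamma> g) 4"
  shows
    "graded_division_algebra G (neutral_centralizer G D \<Gamma>) (centralizer_grading G D \<Gamma>) \<and>
     (\<forall>g \<in> grading_support G (neutral_centralizer G D \<Gamma>) (centralizer_grading G D \<Gamma>).
        has_dim (neutral_centralizer G D \<Gamma>) (centralizer_grading G D \<Gamma> g) 1) \<and>
     graded_isomorphic G D \<Gamma>
       (tensor_algebra (neutral_subalgebra G D \<Gamma>) (neutral_centralizer G D \<Gamma>))
       (tensor_grading (neutral_subalgebra G D \<Gamma>) (neutral_centralizer G D \<Gamma>)
          (centralizer_grading G D \<Gamma>)) \<and>
     (graded_division_algebra G D1 \<Gamma>1 \<and>
      (\<forall>g \<in> grading_support G D1 \<Gamma>1. has_dim D1 (\<Gamma>1 g) 4) \<and>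
      graded_isomorphic G (neutral_centralizer G D \<Gamma>) (centralizer_grading G D \<Gamma>)
        (neutral_centralizer G D1 \<Gamma>1) (centralizer_grading G D1 \<Gamma>1)
      \<longrightarrow> graded_isomorphic G D \<Gamma> D1 \<Gamma>1) \<and>
     (graded_division_algebra H D2 \<Gamma>2 \<and>
      (\<forall>h \<in> grading_support H D2 \<Gamma>2. has_dim D2 (\<Gamma>2 h) 4) \<and>
      graded_equivalent G (neutral_centralizer G D \<Gamma>) (centralizer_grading G D \<Gamma>)
        H (neutral_centralizer H D2 \<Gamma>2) (centralizer_grading H D2 \<Gamma>2)
      \<longrightarrow> graded_equivalent G D \<Gamma> H D2 \<Gamma>2)"
proof (intro conjI impI ballI)
  obtain i j where Q: "quaternionic_graded_algebra G D \<Gamma> i j"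
    by (rule graded_division_algebra.neutral_quaternionic[OF D dim4])
  show "graded_division_algebra G (neutral_centralizer G D \<Gamma>) (centralizer_grading G D \<Gamma>)"
    by (rule graded_division_algebra.graded_division_centralizer[OF D])
  show "has_dim (neutral_centralizer G D \<Gamma>) (centralizer_grading G D \<Gamma> g) 1"
    if "g \<in> grading_support G (neutral_centralizer G D \<Gamma>) (centralizer_grading G D \<Gamma>)" for g
    by (rule graded_division_algebra.centralizer_has_dim_1[OF D Q that])
  show "graded_isomorphic G D \<Gamma>
       (tensor_algebra (neutral_subalgebra G D \<Gamma>) (neutral_centralizer G D \<Gamma>))
       (tensor_grading (neutral_subalgebra G D \<Gamma>) (neutral_centralizer G D \<Gamma>)
          (centralizer_grading G D \<Gamma>))"
    by (rule quaternionic_graded_algebra.graded_isomorphic_tensor[OF Q])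
  { assume *: "graded_division_algebra G D1 \<Gamma>1 \<and>
      (\<forall>g \<in> grading_support G D1 \<Gamma>1. has_dim D1 (\<Gamma>1 g) 4) \<and>
      graded_isomorphic G (neutral_centralizer G D \<Gamma>) (centralizer_grading G D \<Gamma>)
        (neutral_centralizer G D1 \<Gamma>1) (centralizer_grading G D1 \<Gamma>1)"
    \<comment> \<open>Units are chosen independently in the two algebras; the extension maps one
      pair to the other, so any two choices match.\<close>
    then obtain i1 j1 where Q1: "quaternionic_graded_algebra G D1 \<Gamma>1 i1 j1"
      by (blast elim: graded_division_algebra.neutral_quaternionic)
    with Q * show "graded_isomorphic G D \<Gamma> D1 \<Gamma>1"
      by (blast intro: graded_isomorphic_of_centralizers) }
  assume *: "graded_division_algebra H D2 \<Gamma>2 \<and>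
      (\<forall>h \<in> grading_support H D2 \<Gamma>2. has_dim D2 (\<Gamma>2 h) 4) \<and>
      graded_equivalent G (neutral_centralizer G D \<Gamma>) (centralizer_grading G D \<Gamma>)
        H (neutral_centralizer H D2 \<Gamma>2) (centralizer_grading H D2 \<Gamma>2)"
  then obtain i2 j2 where Q2: "quaternionic_graded_algebra H D2 \<Gamma>2 i2 j2"
    by (blast elim: graded_division_algebra.neutral_quaternionic)
  with Q * show "graded_equivalent G D \<Gamma> H D2 \<Gamma>2"
    by (blast intro: graded_equivalent_of_centralizers)
qed

end
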